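(* Let $\mathcal{C}_0$ and $\mathcal{C}_1$ be local-progress sequent calculi and let $\alpha:\mathrm{FFT}\to\mathcal{T}(\mathrm{FFT})$ be a proof translation step from $\mathcal{C}_0$ to $\mathcal{C}_1$. Let $F_\alpha$ be the unique coalgebra morphism from $(\mathrm{FFT},\alpha)$ to $(\mathrm{FFT},\mathrm{destruct})$. Then: (i) the restriction of $F_\alpha$ to $\mathrm{FFP}(\mathcal{C}_0)$ maps $\mathrm{FFP}(\mathcal{C}_0)$ into $\mathrm{FFP}(\mathcal{C}_1)$; (ii) the function $\tau\mapsto \mathsf{p}_0(F_\alpha(\tau,\sim^\tau))$, where $\mathsf{p}_0$ is the first projection of an ordered pair, maps every proof in $\mathcal{C}_0$ to a proof in $\mathcal{C}_1$.
   Context: Words are finite sequences of natural numbers; $\mathbb{N}^*$ is the set of words, $\epsilon$ the empty word, $\mathbb{N}^+$ the nonempty words; concatenation is juxtaposition; $\sqsubseteq$ is the prefix order ($\sqsubset$ strict). Finite sequences of elements of $\mathbb{N}^+$ are denoted $r,s$; $\mathsf{nil}$ is the empty sequence, $w{:}r$ and $r{:}w$ prepend/append $w$, and $[w]=w{:}\mathsf{nil}$. A tree is a prefix-closed set of words (nodes) with a labelling $\ell$; trees are finitely branching: each node $w$ has an arity $k$ with $wi$ a node iff $i<k$; leaves are $\sqsubseteq$-maximal nodes. Fix a set $\mathrm{Seq}$ of sequents. A rule instance is a pair $P\Longrightarrow C$ with $P$ a finite sequence of sequents (premises) and $C$ a sequent (conclusion); a rule is a nonempty set of rule instances. A local-progress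 sequent calculus is a pair $\mathcal{C}=(\mathcal{R},L)$ where $\mathcal{R}$ is a set of rules and $L$ assigns to each $R\in\mathcal{R}$ and each instance $(S_0,\dots,S_{k-1}\Longrightarrow S)\in R$ a subset $L_R(S_0,\dots,S_{k-1}\Longrightarrow S)\subseteq\{0,\dots,k-1\}$ (the progressing premises). All trees are labelled by pairs $(S,R)$ with $S$ a sequent and $R$ a rule; write $\mathrm{seq}^\tau(w)$ and $\mathrm{rule}^\tau(w)$ for the two components of the label of $w$. Let $A$ be the set of such label pairs and fix $*\notin A$. A pre-proof in $\mathcal{C}$ is a (possibly infinite) labelled tree $\tau$ such that at every node $w$ of arity $k$, $(\mathrm{seq}^\tau(w0),\dots,\mathrm{seq}^\tau(w(k-1))\Longrightarrow\mathrm{seq}^\tau(w))\in\mathrm{rule}^\tau(w)$. A node $vi$ is progressing if $i\in L_R(\mathrm{seq}^\tau(v0),\dots,\mathrm{seq}^\tau(v(k-1))\Longrightarrow \mathrm{seq}^\tau(v))$ with $R=\mathrm{rule}^\tau(v)$, $k$ the arity of $v$. A proof in $\mathcal{C}$ is a pre-proof such that on every infinite branch $b$ there are infinitely many $i$ with $b\restriction i$ progressing. For a pre-proof $\tau$, let $w\to v$ iff $v=wi$ for some $i$ and $v$ is not progressing, and let $\sim^\tau$ be the equivalence relation generated by $\to$. A finite tree with non-wellfounded leaves is a finite tree $\iota$ labelled in $A\cup\{*\}$ whose root is not labelled $*$ and whose $*$-labelled nodes are leaves; $\mathrm{nwleaf}(\iota)$ is the set of $*$-labelled nodes and $\mathrm{pnodes}(\iota)$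 the others; $\mathrm{NWT}$ is the set of these. The functor $\mathcal{T}$ on Set: $\mathcal{T}(X)=\{(\iota,\mu):\iota\in\mathrm{NWT},\ \mu:\mathrm{nwleaf}(\iota)\to X\}$, $\mathcal{T}(f)(\iota,\mu)=(\iota,f\circ\mu)$. A coalgebra is $(C,\alpha)$ with $\alpha:C\to\mathcal{T}(C)$, writing $\alpha(c)=(\iota^\alpha_c,\mu^\alpha_c)$; a coalgebra morphism $\gamma:(C,\alpha)\to(D,\beta)$ satisfies $\beta\circ\gamma=\mathcal{T}(\gamma)\circ\alpha$. Root-paths: $\mathsf{nil}\in\mathrm{Roots}(\alpha,c)$; $w{:}r\in\mathrm{Roots}(\alpha,c)$ iff $w\in\mathrm{nwleaf}(\iota^\alpha_c)$ and $r\in\mathrm{Roots}(\alpha,\mu^\alpha_c(w))$. For $r\in\mathrm{Roots}(\alpha,c)$: subelement $\mathrm{sub}^\alpha(c,\mathsf{nil})=c$, $\mathrm{sub}^\alpha(c,w{:}r)=\mathrm{sub}^\alpha(\mu^\alpha_c(w),r)$; fragment $\mathrm{frag}^\alpha(c,\mathsf{nil})=\iota^\alpha_c$, $\mathrm{frag}^\alpha(c,w{:}r)=\mathrm{frag}^\alpha(\mu^\alpha_c(w),r)$. A set $F\subseteq\mathbb{N}^*$ has the fragmentation properties if it is finite, has a $\sqsubseteq$-minimum, and is convex (if $w,v\in F$ and $w\sqsubseteq u\sqsubseteq v$ then $u\in F$). A finite-fragmented tree is a pair $\pi=(\tau,\mathcal{F})$ with $\tau$ a (possibly infinite) tree labelled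 in $A$ and $\mathcal{F}$ a partition of its nodes into sets with the fragmentation properties; $\sim^\pi$ is the corresponding equivalence and $\mathrm{FFT}$ the set of these. $\mathrm{roots}(\pi)$ is the set of minima of blocks. For roots $w,v$: $w\lhd v$ iff $w\sqsubset v$ and no root $u$ has $w\sqsubset u\sqsubset v$. For $w\in\mathrm{roots}(\pi)$, the tree fragment $\mathrm{tf}(\pi,w)\in\mathrm{NWT}$ has nodes $\{v: w\sim^\pi wv\}\cup\{u\in\mathbb{N}^+: w\lhd wu\}$, label $\ell^\pi(wv)$ at $v$ if $w\sim^\pi wv$ and $*$ at $u$ if $w\lhd wu$; the subtree $\mathrm{st}(\pi,w)$ has nodes $\{v: wv\text{ node of }\pi\}$, labels $v\mapsto\ell^\pi(wv)$, and $v\sim u$ iff $wv\sim^\pi wu$. $\mathrm{destruct}:\mathrm{FFT}\to\mathcal{T}(\mathrm{FFT})$ is $\pi\mapsto(\mathrm{tf}(\pi,\epsilon),\ w\mapsto\mathrm{st}(\pi,w))$; $(\mathrm{FFT},\mathrm{destruct})$ is a final $\mathcal{T}$-coalgebra. For $\pi\in\mathrm{FFT}$ write $\mathrm{Roots}(\pi)$, $\mathrm{frag}(\pi,r)$, $\mathrm{sub}(\pi,r)$ for the notions w.r.t. $\mathrm{destruct}$. A proof fragment in $\mathcal{C}$ is a pair $(\iota,s)$ with $\iota\in\mathrm{NWT}$, $s:\mathrm{nwleaf}(\iota)\to\mathrm{Seq}$, such that for every $w\in\mathrm{pnodes}(\iota)$ of arity $k$, letting $S_i=\mathrm{seq}^\iota(wi)$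 if $wi\notin\mathrm{nwleaf}(\iota)$ and $S_i=s(wi)$ otherwise, $S=\mathrm{seq}^\iota(w)$, $R=\mathrm{rule}^\iota(w)$: $(S_0,\dots,S_{k-1}\Longrightarrow S)\in R$, and for all $i<k$, $wi\in\mathrm{nwleaf}(\iota)$ iff $i\in L_R(S_0,\dots,S_{k-1}\Longrightarrow S)$. $\mathrm{FFP}(\mathcal{C})$ (finite-fragmented proofs) is the set of $\pi\in\mathrm{FFT}$ such that for every $r\in\mathrm{Roots}(\pi)$ the pair $(\mathrm{frag}(\pi,r),\ v\mapsto\mathrm{seq}^{\mathrm{frag}(\pi,r{:}v)}(\epsilon))$ is a proof fragment in $\mathcal{C}$. A map $\alpha:\mathrm{FFT}\to\mathcal{T}(\mathrm{FFT})$ is a proof translation step from $\mathcal{C}_0$ to $\mathcal{C}_1$ iff for every $\pi\in\mathrm{FFP}(\mathcal{C}_0)$: (1) $(\mathrm{frag}^\alpha(\pi,\mathsf{nil}),\ w\mapsto\mathrm{seq}^{\mathrm{frag}^\alpha(\pi,[w])}(\epsilon))$ is a proof fragment in $\mathcal{C}_1$, and (2) for every $w\in\mathrm{nwleaf}(\mathrm{frag}^\alpha(\pi,\mathsf{nil}))$, $\mathrm{sub}^\alpha(\pi,[w])\in\mathrm{FFP}(\mathcal{C}_0)$. *)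

theory Defs
  imports "HOL-Library.Sublist" "HOL-Library.Disjoint_Sets" "HOL-Library.FuncSet"
begin

section \<open>Trees\<close>

type_synonym word = "nat list"

text \<open>A tree is a partial map from words to labels; its domain is the set of nodes.
  Trees have a root: without it the root fragment of a tree would not be defined.\<close>

definition is_tree :: "(word \<rightharpoonup> 'l) \<Rightarrow> bool" where
  "is_tree t \<longleftrightarrow>
     [] \<in> dom t \<and>
     (\<forall>v \<in> dom t. \<forall>w. prefix w v \<longrightarrow> w \<in> dom t) \<and>
     (\<forall>w \<in> dom t. \<exists>k. \<forall>i. w @ [i] \<in> dom t \<longleftrightarrow> i < k)"

definition arity :: "(word \<rightharpoonup> 'l) \<Rightarrow> word \<Rightarrow> nat" where
  "arity t w = (THE k. \<forall>i. w @ [i] \<in> dom t \<longleftrightarrow> i < k)"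

definition leaves :: "(word \<rightharpoonup> 'l) \<Rightarrow> word set" where
  "leaves t = {w \<in> dom t. \<forall>v \<in> dom t. prefix w v \<longrightarrow> v = w}"

section \<open>Local-progress sequent calculi\<close>

text \<open>The sequents are the elements of the type variable \<open>'s\<close>.\<close>

type_synonym 's inst = "'s list \<times> 's"
type_synonym 's rule = "'s inst set"
type_synonym 's label = "'s \<times> 's rule"
type_synonym 's calculus = "'s rule set \<times> ('s rule \<Rightarrow> 's inst \<Rightarrow> nat set)"

abbreviation rules :: "'s calculus \<Rightarrow> 's rule set" where
  "rules \<equiv> fst"

abbreviation progress :: "'s calculus \<Rightarrow> 's rule \<Rightarrow> 's inst \<Rightarrow> nat set" where
  "progress \<equiv> snd"

definition is_rule :: "'s rule \<Rightarrow> bool" where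
  "is_rule R \<longleftrightarrow> R \<noteq> {}"

definition local_progress_calculus :: "'s calculus \<Rightarrow> bool" where
  "local_progress_calculus C \<longleftrightarrow>
     (\<forall>R \<in> rules C. is_rule R \<and>
        (\<forall>(P, S) \<in> R. progress C R (P, S) \<subseteq> {..<length P}))"

definition labels :: "'s label set" where
  "labels = {(S, R). is_rule R}"

section \<open>Pre-proofs and proofs\<close>

definition seq :: "(word \<rightharpoonup> 's label) \<Rightarrow> word \<Rightarrow> 's" where
  "seq t w = fst (the (t w))"

definition rule_at :: "(word \<rightharpoonup> 's label) \<Rightarrow> word \<Rightarrow> 's rule" where
  "rule_at t w = snd (the (t w))"

definition inst_at :: "(word \<rightharpoonup> 's label) \<Rightarrow> word \<Rightarrow> 's inst" where
  "inst_at t w = (map (\<lambda>i. seq t (w @ [i])) [0..<arity t w], seq t w)"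

definition preproof :: "'s calculus \<Rightarrow> (word \<rightharpoonup> 's label) \<Rightarrow> bool" where
  "preproof C t \<longleftrightarrow>
     is_tree t \<and> ran t \<subseteq> labels \<and>
     (\<forall>w \<in> dom t. rule_at t w \<in> rules C \<and> inst_at t w \<in> rule_at t w)"

definition progressing :: "'s calculus \<Rightarrow> (word \<rightharpoonup> 's label) \<Rightarrow> word \<Rightarrow> bool" where
  "progressing C t w \<longleftrightarrow> w \<in> dom t \<and>
     (\<exists>v i. w = v @ [i] \<and> i \<in> progress C (rule_at t v) (inst_at t v))"

text \<open>The restriction of an infinite branch \<open>b\<close> to its first \<open>i\<close> entries
  is \<open>map b [0..<i]\<close>.\<close>

definition is_proof :: "'s calculus \<Rightarrow> (word \<rightharpoonup> 's label) \<Rightarrow> bool" where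
  "is_proof C t \<longleftrightarrow> preproof C t \<and>
     (\<forall>b :: nat \<Rightarrow> nat. (\<forall>i. map b [0..<i] \<in> dom t) \<longrightarrow>
        infinite {i. progressing C t (map b [0..<i])})"

definition np_edge :: "'s calculus \<Rightarrow> (word \<rightharpoonup> 's label) \<Rightarrow> word \<Rightarrow> word \<Rightarrow> bool" where
  "np_edge C t w v \<longleftrightarrow> w \<in> dom t \<and> v \<in> dom t \<and>
     (\<exists>i. v = w @ [i]) \<and> \<not> progressing C t v"

text \<open>The equivalence relation on the nodes generated by \<^const>\<open>np_edge\<close>,
  given as the partition into its classes.\<close>

definition np_classes :: "'s calculus \<Rightarrow> (word \<rightharpoonup> 's label) \<Rightarrow> word set set" where
  "np_classes C t = dom t // {(w, v). equivclp (np_edge C t) w v}"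

section \<open>Finite trees with non-wellfounded leaves and the functor\<close>

text \<open>The extra label \<open>*\<close> is \<open>None\<close>: a node \<open>w\<close> of \<open>\<iota>\<close> is labelled by \<open>*\<close>
  iff \<open>\<iota> w = Some None\<close>, and by \<open>a\<close> iff \<open>\<iota> w = Some (Some a)\<close>.\<close>

type_synonym 's nwt = "word \<rightharpoonup> 's label option"

definition nwleaf :: "'s nwt \<Rightarrow> word set" where
  "nwleaf \<iota> = {w. \<iota> w = Some None}"

definition pnodes :: "'s nwt \<Rightarrow> word set" where
  "pnodes \<iota> = dom \<iota> - nwleaf \<iota>"

definition NWT :: "'s nwt set" where
  "NWT = {\<iota>. is_tree \<iota> \<and> finite (dom \<iota>) \<and> ran \<iota> \<subseteq> insert None (Some ` labels) \<and>
             [] \<notin> nwleaf \<iota> \<and> nwleaf \<iota> \<subseteq> leaves \<iota>}"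

text \<open>A function from \<open>nwleaf \<iota>\<close> to \<open>X\<close> is a partial map with domain \<open>nwleaf \<iota>\<close>.\<close>

definition T_obj :: "'x set \<Rightarrow> ('s nwt \<times> (word \<rightharpoonup> 'x)) set" where
  "T_obj X = {(\<iota>, \<mu>). \<iota> \<in> NWT \<and> dom \<mu> = nwleaf \<iota> \<and> ran \<mu> \<subseteq> X}"

definition T_map :: "('x \<Rightarrow> 'y) \<Rightarrow> 's nwt \<times> (word \<rightharpoonup> 'x) \<Rightarrow> 's nwt \<times> (word \<rightharpoonup> 'y)" where
  "T_map f = (\<lambda>(\<iota>, \<mu>). (\<iota>, map_option f \<circ> \<mu>))"

definition coalg_morphism ::
  "'c set \<Rightarrow> ('c \<Rightarrow> 's nwt \<times> (word \<rightharpoonup> 'c)) \<Rightarrow>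
   'd set \<Rightarrow> ('d \<Rightarrow> 's nwt \<times> (word \<rightharpoonup> 'd)) \<Rightarrow> ('c \<Rightarrow> 'd) \<Rightarrow> bool" where
  "coalg_morphism C \<alpha> D \<beta> \<gamma> \<longleftrightarrow>
     \<gamma> \<in> C \<rightarrow> D \<and> (\<forall>c \<in> C. \<beta> (\<gamma> c) = T_map \<gamma> (\<alpha> c))"

text \<open>\<open>sub\<close> and \<open>frag\<close> are only meaningful on root-paths.\<close>

primrec is_root_path :: "('c \<Rightarrow> 's nwt \<times> (word \<rightharpoonup> 'c)) \<Rightarrow> 'c \<Rightarrow> word list \<Rightarrow> bool" where
  "is_root_path \<alpha> c [] \<longleftrightarrow> True"
| "is_root_path \<alpha> c (w # r) \<longleftrightarrow>
     w \<in> nwleaf (fst (\<alpha> c)) \<and> is_root_path \<alpha> (the (snd (\<alpha> c) w)) r"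

definition Roots :: "('c \<Rightarrow> 's nwt \<times> (word \<rightharpoonup> 'c)) \<Rightarrow> 'c \<Rightarrow> word list set" where
  "Roots \<alpha> c = {r. is_root_path \<alpha> c r}"

primrec sub :: "('c \<Rightarrow> 's nwt \<times> (word \<rightharpoonup> 'c)) \<Rightarrow> 'c \<Rightarrow> word list \<Rightarrow> 'c" where
  "sub \<alpha> c [] = c"
| "sub \<alpha> c (w # r) = sub \<alpha> (the (snd (\<alpha> c) w)) r"

primrec frag :: "('c \<Rightarrow> 's nwt \<times> (word \<rightharpoonup> 'c)) \<Rightarrow> 'c \<Rightarrow> word list \<Rightarrow> 's nwt" where
  "frag \<alpha> c [] = fst (\<alpha> c)"
| "frag \<alpha> c (w # r) = frag \<alpha> (the (snd (\<alpha> c) w)) r"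

section \<open>Finite-fragmented trees\<close>

type_synonym 's fft = "(word \<rightharpoonup> 's label) \<times> word set set"

definition fragmentation :: "word set \<Rightarrow> bool" where
  "fragmentation F \<longleftrightarrow> finite F \<and>
     (\<exists>m \<in> F. \<forall>v \<in> F. prefix m v) \<and>
     (\<forall>w \<in> F. \<forall>v \<in> F. \<forall>u. prefix w u \<and> prefix u v \<longrightarrow> u \<in> F)"

definition FFT :: "'s fft set" where
  "FFT = {(t, F). is_tree t \<and> ran t \<subseteq> labels \<and>
                  partition_on (dom t) F \<and> (\<forall>B \<in> F. fragmentation B)}"

definition same_block :: "'s fft \<Rightarrow> word \<Rightarrow> word \<Rightarrow> bool" where
  "same_block \<pi> w v \<longleftrightarrow> (\<exists>B \<in> snd \<pi>. w \<in> B \<and> v \<in> B)"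

definition roots :: "'s fft \<Rightarrow> word set" where
  "roots \<pi> = {w. \<exists>B \<in> snd \<pi>. w \<in> B \<and> (\<forall>v \<in> B. prefix w v)}"

definition root_covers :: "'s fft \<Rightarrow> word \<Rightarrow> word \<Rightarrow> bool" where
  "root_covers \<pi> w v \<longleftrightarrow> w \<in> roots \<pi> \<and> v \<in> roots \<pi> \<and> strict_prefix w v \<and>
     \<not> (\<exists>u \<in> roots \<pi>. strict_prefix w u \<and> strict_prefix u v)"

text \<open>On the block of \<open>w\<close>, a label \<open>Some a\<close> of the tree becomes \<open>Some (Some a)\<close>.\<close>

definition tf :: "'s fft \<Rightarrow> word \<Rightarrow> 's nwt" where
  "tf \<pi> w = (\<lambda>v. if same_block \<pi> w (w @ v) then Some (fst \<pi> (w @ v))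
                else if root_covers \<pi> w (w @ v) then Some None
                else None)"

definition st :: "'s fft \<Rightarrow> word \<Rightarrow> 's fft" where
  "st \<pi> w = ((\<lambda>v. fst \<pi> (w @ v)),
             {v. w @ v \<in> dom (fst \<pi>)} // {(v, u). same_block \<pi> (w @ v) (w @ u)})"

definition destruct :: "'s fft \<Rightarrow> 's nwt \<times> (word \<rightharpoonup> 's fft)" where
  "destruct \<pi> = (tf \<pi> [], (\<lambda>w. if w \<in> nwleaf (tf \<pi> []) then Some (st \<pi> w) else None))"

text \<open>The unique coalgebra morphism into the final coalgebra. Only its values on
  \<^const>\<open>FFT\<close> matter; extensionality makes it unique as a function on the whole type.\<close>

definition unfold_morphism :: "('s fft \<Rightarrow> 's nwt \<times> (word \<rightharpoonup> 's fft)) \<Rightarrow> 's fft \<Rightarrow> 's fft" where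
  "unfold_morphism \<alpha> = (THE F. F \<in> extensional FFT \<and> coalg_morphism FFT \<alpha> FFT destruct F)"

section \<open>Finite-fragmented proofs and proof translation steps\<close>

definition nwt_seq :: "'s nwt \<Rightarrow> word \<Rightarrow> 's" where
  "nwt_seq \<iota> w = fst (the (the (\<iota> w)))"

definition nwt_rule :: "'s nwt \<Rightarrow> word \<Rightarrow> 's rule" where
  "nwt_rule \<iota> w = snd (the (the (\<iota> w)))"

text \<open>Only the values of \<open>s\<close> on \<open>nwleaf \<iota>\<close> are used.\<close>

definition proof_fragment :: "'s calculus \<Rightarrow> 's nwt \<Rightarrow> (word \<Rightarrow> 's) \<Rightarrow> bool" where
  "proof_fragment C \<iota> s \<longleftrightarrow> \<iota> \<in> NWT \<and>
     (\<forall>w \<in> pnodes \<iota>.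
        let k = arity \<iota> w;
            Si = (\<lambda>i. if w @ [i] \<in> nwleaf \<iota> then s (w @ [i]) else nwt_seq \<iota> (w @ [i]));
            I = (map Si [0..<k], nwt_seq \<iota> w);
            R = nwt_rule \<iota> w
        in R \<in> rules C \<and> I \<in> R \<and>
           (\<forall>i<k. w @ [i] \<in> nwleaf \<iota> \<longleftrightarrow> i \<in> progress C R I))"

definition FFP :: "'s calculus \<Rightarrow> 's fft set" where
  "FFP C = {\<pi> \<in> FFT. \<forall>r \<in> Roots destruct \<pi>.
     proof_fragment C (frag destruct \<pi> r) (\<lambda>v. nwt_seq (frag destruct \<pi> (r @ [v])) [])}"

definition translation_step ::
  "'s calculus \<Rightarrow> 's calculus \<Rightarrow> ('s fft \<Rightarrow> 's nwt \<times> (word \<rightharpoonup> 's fft)) \<Rightarrow> bool" where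
  "translation_step C0 C1 \<alpha> \<longleftrightarrow> \<alpha> \<in> FFT \<rightarrow> T_obj FFT \<and>
     (\<forall>\<pi> \<in> FFP C0.
        proof_fragment C1 (frag \<alpha> \<pi> []) (\<lambda>w. nwt_seq (frag \<alpha> \<pi> [w]) []) \<and>
        (\<forall>w \<in> nwleaf (frag \<alpha> \<pi> []). sub \<alpha> \<pi> [w] \<in> FFP C0))"

end

theory Submission
  imports Defs
begin

text \<open>
  The image of \<open>c\<close> under the morphism into \<^const>\<open>FFT\<close> is \<open>assemble \<alpha> c\<close>: glue the fragments
  of \<open>c\<close> along its root-paths. Since a morphism preserves root-paths and fragments, and gluing the
  fragments of a finite-fragmented tree gives the tree back, this morphism is unique. Being in
  \<^const>\<open>FFP\<close> depends only on the fragments, so (i) holds because root-paths starting in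
  \<open>FFP C0\<close> never leave it. On the level of nodes, \<open>FFP C\<close> says that the rules are applied
  correctly and that the block roots other than \<open>[]\<close> are exactly the progressing nodes. Hence (ii):
  a branch without progress would stay in one finite block, and conversely Koenig's lemma makes
  the classes of a proof finite.
\<close>

section \<open>Trees\<close>

text \<open>\<open>unfold_morphism\<close> is a definite description, so nothing is known about it
  until a morphism is exhibited and shown unique on \<open>FFT\<close>: finality is proved here, not
  assumed. Gluing is unambiguous because the non-wellfounded leaves of a fragment are pairwise
  incomparable; hence a word splits in at most one way as \<open>concat r @ v\<close> with
  \<open>r\<close> a root-path and \<open>v\<close> a proper node of the fragment at
  \<open>r\<close>. This split, \<open>node_at\<close>, serves twice. For an arbitrary coalgebra it
  defines the glued tree. For \<open>destruct\<close> every node has such a split, with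
  \<open>concat r\<close> the minimum of its block, and this translates between root-paths, in terms
  of which \<open>FFP\<close> is defined, and nodes, in terms of which proofs are. Two local
  descriptions keep the order-theoretic definitions out of later arguments: a node other than the
  empty word is a root iff it lies in a different block than its parent, and equivalent nodes of a
  proof are reached from a common node by non-progressing paths.\<close>

lemma is_tree_prefix: "is_tree t \<Longrightarrow> v \<in> dom t \<Longrightarrow> prefix w v \<Longrightarrow> w \<in> dom t"
  unfolding is_tree_def by blast

lemma is_tree_parent: "is_tree t \<Longrightarrow> v @ [i] \<in> dom t \<Longrightarrow> v \<in> dom t"
  using is_tree_prefix[of t "v @ [i]" v] by simp

lemma arity_eqI:
  assumes "\<And>i. w @ [i] \<in> dom t \<longleftrightarrow> i < k"
  shows "arity t w = k"
  unfolding arity_def using assms by (intro the_equality) (auto, metis nat_neq_iff)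

lemma is_tree_child_iff:
  assumes "is_tree t" "w \<in> dom t"
  shows "w @ [i] \<in> dom t \<longleftrightarrow> i < arity t w"
proof -
  obtain k where k: "\<And>i. w @ [i] \<in> dom t \<longleftrightarrow> i < k"
    using assms unfolding is_tree_def by blast
  show ?thesis unfolding arity_eqI[OF k] by (rule k)
qed

lemma is_treeI:
  assumes "[] \<in> dom t"
    and parent: "\<And>w i. w @ [i] \<in> dom t \<Longrightarrow> w \<in> dom t"
    and "\<And>w. w \<in> dom t \<Longrightarrow> \<exists>k. \<forall>i. w @ [i] \<in> dom t \<longleftrightarrow> i < k"
  shows "is_tree t"
proof -
  have "w @ u \<in> dom t \<Longrightarrow> w \<in> dom t" for w u
    by (induction u rule: rev_induct) (use parent in \<open>auto simp flip: append_assoc\<close>)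
  then show ?thesis using assms unfolding is_tree_def prefix_def by blast
qed

section \<open>Finite trees with non-wellfounded leaves\<close>

lemma pnodes_iff: "w \<in> pnodes \<iota> \<longleftrightarrow> (\<exists>a. \<iota> w = Some (Some a))"
  by (auto simp: pnodes_def nwleaf_def dom_def)

lemma dom_nwt: "dom \<iota> = pnodes \<iota> \<union> nwleaf \<iota>"
  by (auto simp: pnodes_def nwleaf_def)

lemma pnodes_nwleaf_disjoint: "w \<in> pnodes \<iota> \<Longrightarrow> w \<notin> nwleaf \<iota>"
  by (simp add: pnodes_def)

lemma NWT_nwleaf_maximal:
  "\<iota> \<in> NWT \<Longrightarrow> u \<in> nwleaf \<iota> \<Longrightarrow> v \<in> dom \<iota> \<Longrightarrow> prefix u v \<Longrightarrow> v = u"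
  unfolding NWT_def leaves_def by blast

lemma NWT_pnodes_prefix:
  assumes "\<iota> \<in> NWT" "v \<in> pnodes \<iota>" "prefix u v"
  shows "u \<in> pnodes \<iota>"
proof -
  have "v \<in> dom \<iota>" using assms by (simp add: dom_nwt)
  then have "u \<in> dom \<iota>" using assms is_tree_prefix unfolding NWT_def by blast
  moreover have "u \<notin> nwleaf \<iota>"
    using NWT_nwleaf_maximal[OF assms(1) _ \<open>v \<in> dom \<iota>\<close> assms(3)] assms(2)
      pnodes_nwleaf_disjoint by blast
  ultimately show ?thesis by (simp add: dom_nwt)
qed

lemma NWT_parent:
  assumes "\<iota> \<in> NWT" "v @ [i] \<in> dom \<iota>"
  shows "v \<in> pnodes \<iota>"
proof -
  have "v \<in> dom \<iota>" using assms is_tree_parent unfolding NWT_def by blast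
  moreover have "v \<notin> nwleaf \<iota>"
    using NWT_nwleaf_maximal[OF assms(1) _ assms(2)] by auto
  ultimately show ?thesis by (simp add: dom_nwt)
qed

lemma NWT_Nil: "\<iota> \<in> NWT \<Longrightarrow> [] \<in> pnodes \<iota>"
  by (auto simp: NWT_def is_tree_def pnodes_def)

text \<open>Two prefixes of one word are comparable, and comparable leaves are equal. This is the
  source of all uniqueness in the gluing.\<close>

lemma NWT_nwleaf_antichain:
  assumes "\<iota> \<in> NWT" "u \<in> nwleaf \<iota>" "u' \<in> nwleaf \<iota>" "u @ x = u' @ x'"
  shows "u = u' \<and> x = x'"
proof -
  have "prefix u u' \<or> prefix u' u"
    using assms(4) by (metis prefixI prefix_same_cases)
  then have "u = u'" using NWT_nwleaf_maximal[OF assms(1)] assms(2,3) dom_nwt by blast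
  then show ?thesis using assms(4) by simp
qed

section \<open>Finite-fragmented trees\<close>

context
  fixes \<pi> :: "'s fft"
  assumes \<pi>: "\<pi> \<in> FFT"
begin

lemma FFT_tree: "is_tree (fst \<pi>)"
  and FFT_labels: "ran (fst \<pi>) \<subseteq> labels"
  and FFT_partition: "partition_on (dom (fst \<pi>)) (snd \<pi>)"
  and FFT_fragmentation: "B \<in> snd \<pi> \<Longrightarrow> fragmentation B"
  using \<pi> by (auto simp: FFT_def)

lemma FFT_Nil: "[] \<in> dom (fst \<pi>)"
  using FFT_tree by (simp add: is_tree_def)

lemma FFT_Union: "\<Union>(snd \<pi>) = dom (fst \<pi>)"
  using partition_onD1[OF FFT_partition] by simp

lemma FFT_blocks_eq: "B \<in> snd \<pi> \<Longrightarrow> B' \<in> snd \<pi> \<Longrightarrow> w \<in> B \<Longrightarrow> w \<in> B' \<Longrightarrow> B = B'"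
  using partition_onD2[OF FFT_partition] disjointD[of "snd \<pi>" B B'] by blast

lemma same_block_refl: "w \<in> dom (fst \<pi>) \<Longrightarrow> same_block \<pi> w w"
  unfolding FFT_Union[symmetric] same_block_def by blast

lemma same_block_sym: "same_block \<pi> w v \<Longrightarrow> same_block \<pi> v w"
  unfolding same_block_def by blast

lemma same_block_trans: "same_block \<pi> u v \<Longrightarrow> same_block \<pi> v w \<Longrightarrow> same_block \<pi> u w"
  unfolding same_block_def by (metis FFT_blocks_eq)

lemma same_block_dom: "same_block \<pi> u v \<Longrightarrow> u \<in> dom (fst \<pi>) \<and> v \<in> dom (fst \<pi>)"
  unfolding FFT_Union[symmetric] same_block_def by blast

lemma same_block_convex:
  assumes "same_block \<pi> w v" "prefix w u" "prefix u v"
  shows "same_block \<pi> w u"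
proof -
  obtain B where B: "B \<in> snd \<pi>" "w \<in> B" "v \<in> B"
    using assms(1) unfolding same_block_def by blast
  then have "u \<in> B"
    using FFT_fragmentation[OF B(1)] assms(2,3) unfolding fragmentation_def by blast
  then show ?thesis using B unfolding same_block_def by blast
qed

lemma same_block_finite: "finite {v. same_block \<pi> w v}"
proof (cases "w \<in> dom (fst \<pi>)")
  case True
  then obtain B where B: "B \<in> snd \<pi>" "w \<in> B"
    using same_block_refl unfolding same_block_def by blast
  then have "{v. same_block \<pi> w v} \<subseteq> B"
    unfolding same_block_def using FFT_blocks_eq by blast
  then show ?thesis using FFT_fragmentation[OF B(1)] finite_subset
    unfolding fragmentation_def by blast
next
  case False
  then have "{v. same_block \<pi> w v} = {}" using same_block_dom by blast
  then show ?thesis by simp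
qed

lemma ex_root:
  assumes "w \<in> dom (fst \<pi>)"
  shows "\<exists>m \<in> roots \<pi>. same_block \<pi> m w \<and> prefix m w"
proof -
  obtain B where B: "B \<in> snd \<pi>" "w \<in> B"
    using assms same_block_refl unfolding same_block_def by blast
  then obtain m where "m \<in> B" "\<forall>v \<in> B. prefix m v"
    using FFT_fragmentation unfolding fragmentation_def by blast
  then show ?thesis using B unfolding roots_def same_block_def by blast
qed

lemma root_prefix:
  assumes "m \<in> roots \<pi>" "same_block \<pi> m v"
  shows "prefix m v"
  using assms FFT_blocks_eq unfolding same_block_def roots_def by blast

lemma roots_dom: "m \<in> roots \<pi> \<Longrightarrow> m \<in> dom (fst \<pi>)"
  unfolding FFT_Union[symmetric] roots_def by blast

lemma Nil_in_roots: "[] \<in> roots \<pi>"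
  using ex_root[OF FFT_Nil] by simp

text \<open>The minimum of the block of a child is a prefix of the child. If it were a prefix of the
  parent, convexity would put the parent into the same block; otherwise it is the child
  itself.\<close>

lemma snoc_in_roots_iff:
  assumes "v @ [i] \<in> dom (fst \<pi>)"
  shows "v @ [i] \<in> roots \<pi> \<longleftrightarrow> \<not> same_block \<pi> v (v @ [i])"
proof
  assume "v @ [i] \<in> roots \<pi>"
  then show "\<not> same_block \<pi> v (v @ [i])"
    using root_prefix[of "v @ [i]" v] same_block_sym by (auto dest: prefix_length_le)
next
  assume *: "\<not> same_block \<pi> v (v @ [i])"
  obtain m where m: "m \<in> roots \<pi>" "same_block \<pi> m (v @ [i])" "prefix m (v @ [i])"
    using ex_root[OF assms] by blast
  have "\<not> prefix m v"
  proof
    assume "prefix m v"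
    then have "same_block \<pi> m v" using same_block_convex[OF m(2)] by simp
    then show False using * m(2) same_block_sym same_block_trans by blast
  qed
  then show "v @ [i] \<in> roots \<pi>" using m by (simp add: prefix_snoc)
qed

text \<open>Turns the condition that no root lies in between into one about a single edge. The
  minimum of the block of \<open>v\<close> is a root strictly before \<open>v @ [i]\<close>, so it
  has to be \<open>[]\<close>; conversely, a root in between would lie in the block of
  \<open>[]\<close> by convexity and so be \<open>[]\<close>.\<close>

lemma root_covers_Nil_snoc_iff:
  "root_covers \<pi> [] (v @ [i]) \<longleftrightarrow>
     same_block \<pi> [] v \<and> v @ [i] \<in> dom (fst \<pi>) \<and> \<not> same_block \<pi> [] (v @ [i])"
proof
  assume cov: "root_covers \<pi> [] (v @ [i])"
  then have root: "v @ [i] \<in> roots \<pi>" by (simp add: root_covers_def)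
  have dom: "v @ [i] \<in> dom (fst \<pi>)" using root roots_dom by blast
  then obtain m where m: "m \<in> roots \<pi>" "same_block \<pi> m v" "prefix m v"
    using ex_root is_tree_parent[OF FFT_tree] by blast
  have "strict_prefix m (v @ [i])" using m(3) by (auto simp: strict_prefix_def prefix_def)
  then have "m = []" using cov m(1) unfolding root_covers_def strict_prefix_def by fastforce
  then show "same_block \<pi> [] v \<and> v @ [i] \<in> dom (fst \<pi>) \<and> \<not> same_block \<pi> [] (v @ [i])"
    using m(2) dom root snoc_in_roots_iff[OF dom] same_block_sym same_block_trans
    by blast
next
  assume *: "same_block \<pi> [] v \<and> v @ [i] \<in> dom (fst \<pi>) \<and> \<not> same_block \<pi> [] (v @ [i])"
  then have "v @ [i] \<in> roots \<pi>" using snoc_in_roots_iff same_block_trans by blast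
  moreover have False if u: "u \<in> roots \<pi>" "strict_prefix [] u" "strict_prefix u (v @ [i])" for u
  proof -
    have "prefix u v" using u(3) by (auto simp: strict_prefix_def prefix_snoc)
    then have "same_block \<pi> [] u" using same_block_convex[of "[]" v u] * by simp
    then have "same_block \<pi> u []" by (rule same_block_sym)
    then show False using root_prefix[OF u(1)] u(2) by fastforce
  qed
  ultimately show "root_covers \<pi> [] (v @ [i])"
    unfolding root_covers_def using Nil_in_roots by (auto simp: strict_prefix_def)
qed

lemma not_root_covers_Nil_Nil: "\<not> root_covers \<pi> [] []"
  by (simp add: root_covers_def)

lemma same_block_root_covers: "same_block \<pi> [] v \<Longrightarrow> \<not> root_covers \<pi> [] v"
  by (cases v rule: rev_cases) (auto simp: not_root_covers_Nil_Nil root_covers_Nil_snoc_iff)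

section \<open>The root fragment of a finite-fragmented tree\<close>

lemma tf_Nil_eq:
  "tf \<pi> [] v = (if same_block \<pi> [] v then Some (fst \<pi> v)
     else if root_covers \<pi> [] v then Some None else None)"
  by (simp add: tf_def)

lemma pnodes_tf: "pnodes (tf \<pi> []) = {v. same_block \<pi> [] v}"
proof -
  \<comment> \<open>Blocks contain only nodes, so the first branch of \<open>tf\<close> never yields
    \<open>Some None\<close>, which would be read as the label \<open>*\<close>.\<close>
  have "\<exists>a. fst \<pi> v = Some a" if "same_block \<pi> [] v" for v
    using same_block_dom[OF that] by blast
  then show ?thesis by (auto simp: pnodes_iff tf_Nil_eq split: if_splits)
qed

lemma nwleaf_tf: "nwleaf (tf \<pi> []) = {v. root_covers \<pi> [] v}"
proof -
  have "fst \<pi> v \<noteq> None" if "same_block \<pi> [] v" for v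
    using same_block_dom[OF that] by blast
  then have "tf \<pi> [] v = Some None \<longleftrightarrow> root_covers \<pi> [] v" for v
    using same_block_root_covers[of v] unfolding tf_Nil_eq by simp
  then show ?thesis by (simp add: nwleaf_def)
qed

lemma dom_tf: "dom (tf \<pi> []) = {v. same_block \<pi> [] v \<or> root_covers \<pi> [] v}"
  by (auto simp: dom_nwt pnodes_tf nwleaf_tf)

text \<open>No child is lost by cutting out the block: one that leaves the block is kept as a
  \<open>*\<close>-leaf. Hence arities agree.\<close>

lemma tf_child_iff:
  assumes "same_block \<pi> [] v"
  shows "v @ [i] \<in> dom (tf \<pi> []) \<longleftrightarrow> v @ [i] \<in> dom (fst \<pi>)"
  using assms same_block_dom[of "[]" "v @ [i]"] unfolding dom_tf mem_Collect_eq
    root_covers_Nil_snoc_iff by blast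

lemma tf_parent:
  assumes "v @ [i] \<in> dom (tf \<pi> [])"
  shows "same_block \<pi> [] v"
  using assms same_block_convex[of "[]" "v @ [i]" v] unfolding dom_tf mem_Collect_eq
    root_covers_Nil_snoc_iff by auto

lemma tf_child_iff_arity:
  assumes "same_block \<pi> [] v"
  shows "v @ [i] \<in> dom (tf \<pi> []) \<longleftrightarrow> i < arity (fst \<pi>) v"
  unfolding tf_child_iff[OF assms]
  by (rule is_tree_child_iff[OF FFT_tree conjunct2[OF same_block_dom[OF assms]]])

lemma arity_tf: "same_block \<pi> [] v \<Longrightarrow> arity (tf \<pi> []) v = arity (fst \<pi>) v"
  by (rule arity_eqI) (rule tf_child_iff_arity)

lemma tf_NWT: "tf \<pi> [] \<in> NWT"
proof -
  let ?t = "tf \<pi> []"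
  have tree: "is_tree ?t"
  proof (rule is_treeI)
    show "[] \<in> dom ?t" using same_block_refl[OF FFT_Nil] by (simp add: dom_tf)
  next
    fix w i assume "w @ [i] \<in> dom ?t"
    then show "w \<in> dom ?t" using tf_parent unfolding dom_tf by blast
  next
    fix w assume w: "w \<in> dom ?t"
    show "\<exists>k. \<forall>i. w @ [i] \<in> dom ?t \<longleftrightarrow> i < k"
    proof (cases "same_block \<pi> [] w")
      case True
      show ?thesis using tf_child_iff_arity[OF True] by (intro exI allI)
    next
      case False
      then have "w @ [i] \<notin> dom ?t" for i using tf_parent by blast
      then show ?thesis by (intro exI[of _ 0]) simp
    qed
  qed
  \<comment> \<open>The fragment reaches only one layer of children beyond its block, which is
    finite and finitely branching.\<close>
  have "dom ?t \<subseteq> insert [] (\<Union>v \<in> {v. same_block \<pi> [] v}. (\<lambda>i. v @ [i]) ` {..<arity (fst \<pi>) v})"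
  proof
    fix w assume w: "w \<in> dom ?t"
    show "w \<in> insert [] (\<Union>v \<in> {v. same_block \<pi> [] v}. (\<lambda>i. v @ [i]) ` {..<arity (fst \<pi>) v})"
    proof (cases w rule: rev_cases)
      case (snoc v i)
      then have "same_block \<pi> [] v" using w tf_parent by blast
      moreover from this have "i < arity (fst \<pi>) v"
        using w tf_child_iff_arity unfolding snoc by simp
      ultimately show ?thesis using snoc by blast
    qed simp
  qed
  then have fin: "finite (dom ?t)"
    by (rule finite_subset) (use same_block_finite in auto)
  have "ran ?t \<subseteq> insert None (Some ` labels)"
  proof
    fix x assume "x \<in> ran ?t"
    then obtain v where v: "?t v = Some x" by (auto simp: ran_def)
    show "x \<in> insert None (Some ` labels)"
    proof (cases x)
      case (Some a)
      then have "fst \<pi> v = Some a" using v by (auto simp: tf_Nil_eq split: if_splits)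
      then have "a \<in> labels" using FFT_labels by (auto intro: ranI)
      then show ?thesis using Some by simp
    qed simp
  qed
  moreover have "[] \<notin> nwleaf ?t" by (simp add: nwleaf_tf not_root_covers_Nil_Nil)
  moreover have "nwleaf ?t \<subseteq> leaves ?t"
  proof
    fix u assume u: "u \<in> nwleaf ?t"
    have "v = u" if "v \<in> dom ?t" "prefix u v" for v
    proof (rule ccontr)
      assume "v \<noteq> u"
      then obtain w i where w: "v = w @ [i]" "prefix u w"
        using \<open>prefix u v\<close> by (cases v rule: rev_cases) auto
      then have "same_block \<pi> [] u"
        using tf_parent \<open>v \<in> dom ?t\<close> same_block_convex[of "[]" w u] by simp
      then show False using u same_block_root_covers by (simp add: nwleaf_tf)
    qed
    then show "u \<in> leaves ?t" using u unfolding leaves_def by (simp add: dom_nwt)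
  qed
  ultimately show ?thesis using tree fin by (simp add: NWT_def)
qed

section \<open>Subtrees of a finite-fragmented tree\<close>

lemma fst_st: "fst (st \<pi> w) v = fst \<pi> (w @ v)"
  by (simp add: st_def)

lemma dom_st: "v \<in> dom (fst (st \<pi> w)) \<longleftrightarrow> w @ v \<in> dom (fst \<pi>)"
  by (simp add: domIff fst_st)

lemma equiv_st:
  "equiv {v. w @ v \<in> dom (fst \<pi>)} {(v, u). same_block \<pi> (w @ v) (w @ u)}"
proof (rule equivI)
  show "sym {(v, u). same_block \<pi> (w @ v) (w @ u)}"
    by (rule symI) (simp add: same_block_sym)
  show "trans {(v, u). same_block \<pi> (w @ v) (w @ u)}"
    by (rule transI) (use same_block_trans in blast)
qed (use same_block_dom same_block_refl in \<open>auto simp: refl_on_def\<close>)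

lemma same_block_st: "same_block (st \<pi> w) v u \<longleftrightarrow> same_block \<pi> (w @ v) (w @ u)"
proof
  assume "same_block (st \<pi> w) v u"
  then obtain x where "same_block \<pi> (w @ x) (w @ v)" "same_block \<pi> (w @ x) (w @ u)"
    unfolding same_block_def[of "st \<pi> w"] unfolding st_def quotient_def by auto
  then show "same_block \<pi> (w @ v) (w @ u)"
    using same_block_sym same_block_trans by blast
next
  assume *: "same_block \<pi> (w @ v) (w @ u)"
  let ?B = "{(v, u). same_block \<pi> (w @ v) (w @ u)} `` {v}"
  have dom: "w @ v \<in> dom (fst \<pi>)" using same_block_dom[OF *] by blast
  then have "?B \<in> snd (st \<pi> w)" unfolding st_def snd_conv by (intro quotientI) simp
  moreover have "v \<in> ?B" "u \<in> ?B" using * same_block_refl[OF dom] by auto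
  ultimately show "same_block (st \<pi> w) v u"
    unfolding same_block_def[of "st \<pi> w"] by (intro bexI[of _ ?B] conjI)
qed

lemma st_FFT:
  assumes w: "w \<in> dom (fst \<pi>)"
  shows "st \<pi> w \<in> FFT"
proof -
  have "is_tree (fst (st \<pi> w))"
  proof (rule is_treeI)
    show "[] \<in> dom (fst (st \<pi> w))" using w by (simp add: dom_st)
    show "v @ [i] \<in> dom (fst (st \<pi> w)) \<Longrightarrow> v \<in> dom (fst (st \<pi> w))" for v i
      using is_tree_parent[OF FFT_tree, of "w @ v" i] by (simp add: dom_st)
    show "v \<in> dom (fst (st \<pi> w)) \<Longrightarrow> \<exists>k. \<forall>i. v @ [i] \<in> dom (fst (st \<pi> w)) \<longleftrightarrow> i < k" for v
      using is_tree_child_iff[OF FFT_tree, of "w @ v"] by (auto simp: dom_st)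
  qed
  moreover have "ran (fst (st \<pi> w)) \<subseteq> labels"
    using FFT_labels by (auto simp: ran_def fst_st)
  moreover have "partition_on (dom (fst (st \<pi> w))) (snd (st \<pi> w))"
    using partition_on_quotient[OF equiv_st[of w]] by (auto simp: st_def dom_def)
  moreover have "fragmentation B" if B: "B \<in> snd (st \<pi> w)" for B
  proof -
    obtain x where x: "w @ x \<in> dom (fst \<pi>)" and B: "B = {v. same_block \<pi> (w @ x) (w @ v)}"
      using B unfolding st_def quotient_def snd_conv by blast
    have "finite B"
    proof (rule finite_imageD)
      show "finite ((@) w ` B)"
        by (rule finite_subset[OF _ same_block_finite[of "w @ x"]]) (auto simp: B)
    qed (simp add: inj_on_def)
    moreover have "\<exists>m \<in> B. \<forall>v \<in> B. prefix m v"
    proof -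
      obtain m where m: "m \<in> roots \<pi>" "same_block \<pi> m (w @ x)" "prefix m (w @ x)"
        using ex_root[OF x] by blast
      \<comment> \<open>Since \<open>w\<close> is an arbitrary node, it may cut a block in two: the
        minimum \<open>m\<close> of the block can be a proper prefix of \<open>w\<close>. Then
        convexity puts \<open>w\<close> into the block, and \<open>[]\<close> is the minimum of what
        remains.\<close>
      show ?thesis
      proof (cases "prefix w m")
        case True
        then obtain m' where m': "m = w @ m'" by (auto simp: prefix_def)
        have "m' \<in> B" using same_block_sym[OF m(2)] m' by (simp add: B)
        moreover have "prefix m' v" if "v \<in> B" for v
        proof -
          have "same_block \<pi> m (w @ v)" using same_block_trans[OF m(2)] that unfolding B by blast
          then have "prefix m (w @ v)" by (rule root_prefix[OF m(1)])
          then show ?thesis by (simp add: m')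
        qed
        ultimately show ?thesis by blast
      next
        case False
        then have "prefix m w" using m(3) by (metis prefixI prefix_same_cases)
        then have "same_block \<pi> m w" using same_block_convex[OF m(2)] by simp
        then have "same_block \<pi> (w @ x) w" using m(2) same_block_sym same_block_trans by blast
        then have "[] \<in> B" by (simp add: B)
        then show ?thesis by (intro bexI[of _ "[]"]) simp_all
      qed
    qed
    moreover have "u \<in> B" if "v \<in> B" "v' \<in> B" "prefix v u" "prefix u v'" for u v v'
    proof -
      have "same_block \<pi> (w @ v) (w @ v')"
        using that(1,2) same_block_sym same_block_trans unfolding B by blast
      then have "same_block \<pi> (w @ v) (w @ u)" using same_block_convex that by simp
      then show ?thesis using that(1) same_block_trans unfolding B by blast
    qed
    ultimately show ?thesis unfolding fragmentation_def by blast
  qed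
  ultimately show ?thesis by (auto simp: FFT_def split: prod.splits)
qed

lemma root_covers_Nil_dom: "root_covers \<pi> [] u \<Longrightarrow> u \<in> dom (fst \<pi>)"
  using roots_dom by (simp add: root_covers_def)

lemma destruct_T_obj: "destruct \<pi> \<in> T_obj FFT"
proof -
  have "ran (snd (destruct \<pi>)) \<subseteq> FFT"
  proof
    fix \<rho> assume "\<rho> \<in> ran (snd (destruct \<pi>))"
    then obtain u where "root_covers \<pi> [] u" "\<rho> = st \<pi> u"
      by (auto simp: destruct_def ran_def nwleaf_tf split: if_splits)
    then show "\<rho> \<in> FFT" using st_FFT[OF root_covers_Nil_dom] by simp
  qed
  moreover have "dom (snd (destruct \<pi>)) = nwleaf (tf \<pi> [])"
    by (auto simp: destruct_def split: if_splits)
  ultimately show ?thesis using tf_NWT by (simp add: T_obj_def destruct_def)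
qed

end

text \<open>A partition is the quotient by its own equivalence, so sets of blocks need not be
  compared. This suits \<open>st\<close>, whose blocks are given as a quotient.\<close>

lemma FFT_eqI:
  assumes "\<pi> \<in> FFT" "\<pi>' \<in> FFT" "fst \<pi> = fst \<pi>'"
    and "\<And>w v. same_block \<pi> w v \<longleftrightarrow> same_block \<pi>' w v"
  shows "\<pi> = \<pi>'"
proof -
  have "snd \<rho> = dom (fst \<rho>) // {(x, y). same_block \<rho> x y}" if "\<rho> \<in> FFT" for \<rho> :: "'a fft"
    using partition_on_eq_quotient[OF FFT_partition[OF that]] by (simp add: same_block_def)
  then have "snd \<pi> = snd \<pi>'" using assms by simp
  then show ?thesis using assms(3) by (simp add: prod_eq_iff)
qed

lemma st_Nil: "\<pi> \<in> FFT \<Longrightarrow> st \<pi> [] = \<pi>"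
  by (rule FFT_eqI) (auto simp: st_FFT FFT_Nil fst_st same_block_st)

lemma st_st:
  assumes "\<pi> \<in> FFT" "w @ v \<in> dom (fst \<pi>)"
  shows "st (st \<pi> w) v = st \<pi> (w @ v)"
proof -
  have w: "w \<in> dom (fst \<pi>)" using is_tree_prefix[OF FFT_tree] assms by (metis prefixI)
  note st = st_FFT[OF assms(1) w]
  show ?thesis
    by (rule FFT_eqI)
      (use assms st in \<open>auto simp: st_FFT fst_st dom_st same_block_st\<close>)
qed

section \<open>Coalgebras\<close>

lemma frag_sub: "frag \<alpha> c r = fst (\<alpha> (sub \<alpha> c r))"
  by (induction r arbitrary: c) auto

lemma sub_append: "sub \<alpha> c (r @ r') = sub \<alpha> (sub \<alpha> c r) r'"
  by (induction r arbitrary: c) auto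

lemma is_root_path_append:
  "is_root_path \<alpha> c (r @ r') \<longleftrightarrow> is_root_path \<alpha> c r \<and> is_root_path \<alpha> (sub \<alpha> c r) r'"
  by (induction r arbitrary: c) auto

lemma Nil_in_Roots: "[] \<in> Roots \<alpha> c"
  by (simp add: Roots_def)

lemma Cons_in_Roots_iff:
  "u # r \<in> Roots \<alpha> c \<longleftrightarrow> u \<in> nwleaf (fst (\<alpha> c)) \<and> r \<in> Roots \<alpha> (the (snd (\<alpha> c) u))"
  by (simp add: Roots_def)

lemma snoc_in_Roots_iff:
  "r @ [u] \<in> Roots \<alpha> c \<longleftrightarrow> r \<in> Roots \<alpha> c \<and> u \<in> nwleaf (frag \<alpha> c r)"
  by (simp add: Roots_def is_root_path_append frag_sub)

definition node_at ::
  "('c \<Rightarrow> 's nwt \<times> (word \<rightharpoonup> 'c)) \<Rightarrow> 'c \<Rightarrow> word \<Rightarrow> word list \<Rightarrow> word \<Rightarrow> bool" where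
  "node_at \<alpha> c w r v \<longleftrightarrow> r \<in> Roots \<alpha> c \<and> v \<in> pnodes (frag \<alpha> c r) \<and> w = concat r @ v"

text \<open>One block per root-path. Here \<open>x\<close> is itself an option: stripping one
  \<open>Some\<close> from the value of a fragment at a proper node leaves exactly the value of the
  glued tree.\<close>

definition assemble :: "('c \<Rightarrow> 's nwt \<times> (word \<rightharpoonup> 'c)) \<Rightarrow> 'c \<Rightarrow> 's fft" where
  "assemble \<alpha> c =
     ((\<lambda>w. if \<exists>r v. node_at \<alpha> c w r v
           then THE x. \<exists>r v. node_at \<alpha> c w r v \<and> frag \<alpha> c r v = Some x else None),
      (\<lambda>r. {w. \<exists>v. node_at \<alpha> c w r v}) ` Roots \<alpha> c)"

lemma node_at_Nil: "node_at \<alpha> c w [] v \<longleftrightarrow> v = w \<and> w \<in> pnodes (fst (\<alpha> c))"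
  by (auto simp: node_at_def Nil_in_Roots)

lemma node_at_Cons:
  "node_at \<alpha> c w (u # r) v \<longleftrightarrow> u \<in> nwleaf (fst (\<alpha> c)) \<and>
     (\<exists>x. w = u @ x \<and> node_at \<alpha> (the (snd (\<alpha> c) u)) x r v)"
  by (auto simp: node_at_def Cons_in_Roots_iff)

section \<open>Gluing the fragments over a coalgebra\<close>

locale T_coalgebra =
  fixes C :: "'c set" and \<alpha> :: "'c \<Rightarrow> 's nwt \<times> (word \<rightharpoonup> 'c)"
  assumes maps_to: "\<alpha> \<in> C \<rightarrow> T_obj C"
begin

lemma fragment_NWT: "c \<in> C \<Longrightarrow> fst (\<alpha> c) \<in> NWT"
  using funcset_mem[OF maps_to] unfolding T_obj_def by fastforce

lemma successor_eq:
  assumes "c \<in> C"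
  shows "u \<in> nwleaf (fst (\<alpha> c)) \<longleftrightarrow> (\<exists>d. snd (\<alpha> c) u = Some d)"
proof -
  have "dom (snd (\<alpha> c)) = nwleaf (fst (\<alpha> c))"
    using funcset_mem[OF maps_to assms] by (cases "\<alpha> c") (simp add: T_obj_def)
  then show ?thesis unfolding dom_def by auto
qed

lemma successor_closed:
  assumes "c \<in> C" "u \<in> nwleaf (fst (\<alpha> c))"
  shows "the (snd (\<alpha> c) u) \<in> C"
proof -
  obtain d where "snd (\<alpha> c) u = Some d" using assms successor_eq by blast
  moreover have "ran (snd (\<alpha> c)) \<subseteq> C"
    using funcset_mem[OF maps_to assms(1)] by (cases "\<alpha> c") (simp add: T_obj_def)
  ultimately show ?thesis by (auto simp: ran_def)
qed

lemma sub_closed: "c \<in> C \<Longrightarrow> r \<in> Roots \<alpha> c \<Longrightarrow> sub \<alpha> c r \<in> C"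
  by (induction r arbitrary: c) (simp_all add: Cons_in_Roots_iff successor_closed)

lemma frag_NWT: "c \<in> C \<Longrightarrow> r \<in> Roots \<alpha> c \<Longrightarrow> frag \<alpha> c r \<in> NWT"
  by (simp add: frag_sub fragment_NWT sub_closed)

lemma node_at_Nil_Cons:
  assumes "c \<in> C" "node_at \<alpha> c w [] v" "node_at \<alpha> c w (u # r) v'"
  shows False
proof -
  have "w \<in> pnodes (fst (\<alpha> c))" using assms(2) by (simp add: node_at_Nil)
  moreover have "prefix u w" "u \<in> nwleaf (fst (\<alpha> c))"
    using assms(3) by (auto simp: node_at_Cons)
  ultimately show False
    using NWT_pnodes_prefix[OF fragment_NWT[OF assms(1)]] pnodes_nwleaf_disjoint by blast
qed

text \<open>The split is forced at each stage: if \<open>w\<close> is a proper node of the current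
  fragment, no \<open>*\<close>-leaf is a prefix of it and the path ends; otherwise at most one
  \<open>*\<close>-leaf is a prefix of it, and this is the next entry of the path.\<close>

lemma node_at_unique:
  "c \<in> C \<Longrightarrow> node_at \<alpha> c w r v \<Longrightarrow> node_at \<alpha> c w r' v' \<Longrightarrow> r = r' \<and> v = v'"
proof (induction r arbitrary: c w r')
  case Nil
  show ?case
  proof (cases r')
    case Nil
    then show ?thesis using Nil.prems by (simp add: node_at_Nil)
  next
    case (Cons u s)
    then show ?thesis using node_at_Nil_Cons[OF Nil(1)] Nil.prems by blast
  qed
next
  case IH: (Cons u r)
  show ?case
  proof (cases r')
    case Nil
    then show ?thesis using node_at_Nil_Cons[OF IH(2)] IH.prems by blast
  next
    case (Cons u' s)
    obtain x where x: "u \<in> nwleaf (fst (\<alpha> c))" "w = u @ x"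
        "node_at \<alpha> (the (snd (\<alpha> c) u)) x r v"
      using IH.prems(2) by (auto simp: node_at_Cons)
    obtain x' where x': "u' \<in> nwleaf (fst (\<alpha> c))" "w = u' @ x'"
        "node_at \<alpha> (the (snd (\<alpha> c) u')) x' s v'"
      using IH.prems(3) unfolding Cons by (auto simp: node_at_Cons)
    have "u = u'" "x = x'"
      using NWT_nwleaf_antichain[OF fragment_NWT[OF IH.prems(1)] x(1) x'(1), of x x'] x(2) x'(2)
      by simp_all
    then show ?thesis
      using IH.IH[OF successor_closed[OF IH.prems(1) x(1)] x(3)] x'(3) Cons by simp
  qed
qed

lemma frag_assemble:
  assumes "c \<in> C" "node_at \<alpha> c w r v"
  shows "frag \<alpha> c r v = Some (fst (assemble \<alpha> c) w)"
proof -
  obtain a where a: "frag \<alpha> c r v = Some (Some a)"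
    using assms(2) by (auto simp: node_at_def pnodes_iff)
  have "(THE x. \<exists>r v. node_at \<alpha> c w r v \<and> frag \<alpha> c r v = Some x) = Some a"
  proof (rule the_equality)
    fix x assume "\<exists>r v. node_at \<alpha> c w r v \<and> frag \<alpha> c r v = Some x"
    then obtain r' v' where "node_at \<alpha> c w r' v'" "frag \<alpha> c r' v' = Some x" by blast
    then show "x = Some a" using node_at_unique[OF assms] a by auto
  qed (use assms(2) a in blast)
  then show ?thesis using assms(2) a by (auto simp: assemble_def)
qed

lemma dom_assemble:
  assumes "c \<in> C"
  shows "w \<in> dom (fst (assemble \<alpha> c)) \<longleftrightarrow> (\<exists>r v. node_at \<alpha> c w r v)"
proof
  assume "\<exists>r v. node_at \<alpha> c w r v"
  then obtain r v where rv: "node_at \<alpha> c w r v" by blast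
  then obtain a where "frag \<alpha> c r v = Some (Some a)" by (auto simp: node_at_def pnodes_iff)
  then show "w \<in> dom (fst (assemble \<alpha> c))" using frag_assemble[OF assms rv] by auto
next
  assume "w \<in> dom (fst (assemble \<alpha> c))"
  then show "\<exists>r v. node_at \<alpha> c w r v"
    unfolding assemble_def fst_conv domIff by meson
qed

lemma same_block_assemble:
  "same_block (assemble \<alpha> c) w w' \<longleftrightarrow> (\<exists>r v v'. node_at \<alpha> c w r v \<and> node_at \<alpha> c w' r v')"
proof -
  have "r \<in> Roots \<alpha> c" if "node_at \<alpha> c w r v" for r v
    using that by (simp add: node_at_def)
  then show ?thesis unfolding same_block_def assemble_def by auto
qed

text \<open>If \<open>v\<close> is empty, the node is the root of a fragment and the last entry of
  \<open>r\<close> ends in \<open>i\<close>; that entry is nonempty because roots are not labelled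
  \<open>*\<close>, so the parent lies in the preceding fragment. There \<open>x @ [i]\<close> is a
  \<open>*\<close>-leaf, which is why the conclusion speaks of \<open>dom\<close> and not of
  \<open>pnodes\<close>.\<close>

lemma node_at_parent:
  assumes "c \<in> C" "node_at \<alpha> c (w @ [i]) r v"
  shows "\<exists>s x. s \<in> Roots \<alpha> c \<and> x @ [i] \<in> dom (frag \<alpha> c s) \<and> w = concat s @ x"
proof (cases v rule: rev_cases)
  case (snoc x j)
  then show ?thesis using assms(2) by (auto simp: node_at_def dom_nwt)
next
  case Nil
  have r: "r \<in> Roots \<alpha> c" "w @ [i] = concat r" using assms(2) Nil by (auto simp: node_at_def)
  then obtain s u where s: "r = s @ [u]" by (cases r rule: rev_cases) auto
  then have "s \<in> Roots \<alpha> c" and u: "u \<in> nwleaf (frag \<alpha> c s)"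
    using r(1) by (simp_all add: snoc_in_Roots_iff)
  then have "u \<noteq> []" using frag_NWT[OF assms(1)] unfolding NWT_def by blast
  then obtain x j where "u = x @ [j]" by (cases u rule: rev_cases) auto
  then show ?thesis using \<open>s \<in> Roots \<alpha> c\<close> u r(2) s by (auto simp: dom_nwt)
qed

text \<open>The arity in the glued tree can thus be read off a single fragment: a
  \<open>*\<close>-leaf survives as the root of the next fragment.\<close>

lemma node_at_child:
  assumes "c \<in> C" "node_at \<alpha> c w r v"
  shows "w @ [i] \<in> dom (fst (assemble \<alpha> c)) \<longleftrightarrow> v @ [i] \<in> dom (frag \<alpha> c r)"
proof
  have r: "r \<in> Roots \<alpha> c" "w = concat r @ v" using assms(2) by (auto simp: node_at_def)
  assume "v @ [i] \<in> dom (frag \<alpha> c r)"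
  then consider "v @ [i] \<in> pnodes (frag \<alpha> c r)" | "v @ [i] \<in> nwleaf (frag \<alpha> c r)"
    by (auto simp: dom_nwt)
  then have "\<exists>r' v'. node_at \<alpha> c (w @ [i]) r' v'"
  proof cases
    case 1
    then have "node_at \<alpha> c (w @ [i]) r (v @ [i])" using r by (simp add: node_at_def)
    then show ?thesis by blast
  next
    case 2
    then have "r @ [v @ [i]] \<in> Roots \<alpha> c" using r by (simp add: snoc_in_Roots_iff)
    then have "node_at \<alpha> c (w @ [i]) (r @ [v @ [i]]) []"
      using r NWT_Nil[OF frag_NWT[OF assms(1)]] by (simp add: node_at_def)
    then show ?thesis by blast
  qed
  then show "w @ [i] \<in> dom (fst (assemble \<alpha> c))" by (simp only: dom_assemble[OF assms(1)])
next
  assume "w @ [i] \<in> dom (fst (assemble \<alpha> c))"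
  then obtain r' v' where n: "node_at \<alpha> c (w @ [i]) r' v'"
    unfolding dom_assemble[OF assms(1)] by blast
  obtain s x where s: "s \<in> Roots \<alpha> c" "x @ [i] \<in> dom (frag \<alpha> c s)" "w = concat s @ x"
    using node_at_parent[OF assms(1) n] by blast
  then have "node_at \<alpha> c w s x"
    using NWT_parent[OF frag_NWT[OF assms(1)]] by (simp add: node_at_def)
  then have "s = r" "x = v" using node_at_unique[OF assms] by blast+
  then show "v @ [i] \<in> dom (frag \<alpha> c r)" using s(2) by simp
qed

lemma assemble_FFT:
  assumes c: "c \<in> C"
  shows "assemble \<alpha> c \<in> FFT"
proof -
  let ?t = "fst (assemble \<alpha> c)"
  have "is_tree ?t"
  proof (rule is_treeI)
    have "node_at \<alpha> c [] [] []" using NWT_Nil[OF fragment_NWT[OF c]] by (simp add: node_at_Nil)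
    then show "[] \<in> dom ?t" unfolding dom_assemble[OF c] by blast
  next
    fix w i assume "w @ [i] \<in> dom ?t"
    then obtain r v where n: "node_at \<alpha> c (w @ [i]) r v"
      unfolding dom_assemble[OF c] by blast
    obtain s x where s: "s \<in> Roots \<alpha> c" "x @ [i] \<in> dom (frag \<alpha> c s)" "w = concat s @ x"
      using node_at_parent[OF c n] by blast
    then have "node_at \<alpha> c w s x"
      using NWT_parent[OF frag_NWT[OF c]] by (simp add: node_at_def)
    then show "w \<in> dom ?t" unfolding dom_assemble[OF c] by blast
  next
    fix w assume "w \<in> dom ?t"
    then obtain r v where n: "node_at \<alpha> c w r v" unfolding dom_assemble[OF c] by blast
    then have r: "r \<in> Roots \<alpha> c" "v \<in> dom (frag \<alpha> c r)" by (auto simp: node_at_def dom_nwt)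
    then have "is_tree (frag \<alpha> c r)" using frag_NWT[OF c] unfolding NWT_def by blast
    then show "\<exists>k. \<forall>i. w @ [i] \<in> dom ?t \<longleftrightarrow> i < k"
      unfolding node_at_child[OF c n] using is_tree_child_iff r(2) by blast
  qed
  moreover have "ran ?t \<subseteq> labels"
  proof
    fix a assume "a \<in> ran ?t"
    then obtain w where w: "?t w = Some a" by (auto simp: ran_def)
    then have "w \<in> dom ?t" by blast
    then obtain r v where n: "node_at \<alpha> c w r v" unfolding dom_assemble[OF c] by blast
    then have "Some a \<in> ran (frag \<alpha> c r)" using frag_assemble[OF c n] w by (auto intro: ranI)
    moreover have "r \<in> Roots \<alpha> c" using n by (simp add: node_at_def)
    ultimately show "a \<in> labels" using frag_NWT[OF c] unfolding NWT_def by blast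
  qed
  moreover have "partition_on (dom ?t) (snd (assemble \<alpha> c))"
  proof (rule partition_onI)
    show "\<Union>(snd (assemble \<alpha> c)) = dom ?t"
    proof (rule set_eqI)
      have "r \<in> Roots \<alpha> c" if "node_at \<alpha> c w r v" for w r v
        using that by (simp add: node_at_def)
      then show "w \<in> \<Union>(snd (assemble \<alpha> c)) \<longleftrightarrow> w \<in> dom ?t" for w
        unfolding dom_assemble[OF c] unfolding assemble_def snd_conv by blast
    qed
  next
    have "concat r \<in> {w. \<exists>v. node_at \<alpha> c w r v}" if "r \<in> Roots \<alpha> c" for r
      using NWT_Nil[OF frag_NWT[OF c that]] that by (simp add: node_at_def)
    then show "{} \<notin> snd (assemble \<alpha> c)" unfolding assemble_def snd_conv by blast
  next
    fix B B' assume BB': "B \<in> snd (assemble \<alpha> c)" "B' \<in> snd (assemble \<alpha> c)" "B \<noteq> B'"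
    then obtain r r' where r: "B = {w. \<exists>v. node_at \<alpha> c w r v}" "B' = {w. \<exists>v. node_at \<alpha> c w r' v}"
      unfolding assemble_def snd_conv by blast
    have False if "w \<in> B" "w \<in> B'" for w
    proof -
      have "r = r'" using that node_at_unique[OF c] unfolding r by blast
      then show False using BB'(3) r by simp
    qed
    then show "disjnt B B'" unfolding disjnt_def by blast
  qed
  moreover have "fragmentation B" if B: "B \<in> snd (assemble \<alpha> c)" for B
  proof -
    obtain r where r: "r \<in> Roots \<alpha> c" "B = {w. \<exists>v. node_at \<alpha> c w r v}"
      using B unfolding assemble_def snd_conv by blast
    \<comment> \<open>A block is a translate of the proper nodes of one fragment and inherits
      finiteness, minimum and convexity from them.\<close>
    then have B: "B = (@) (concat r) ` pnodes (frag \<alpha> c r)" by (auto simp: node_at_def)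
    note \<iota> = frag_NWT[OF c r(1)]
    have "finite (pnodes (frag \<alpha> c r))" using \<iota> by (simp add: NWT_def pnodes_def)
    then have "finite B" by (simp add: B)
    moreover have "concat r \<in> B" "\<forall>v \<in> B. prefix (concat r) v"
      using NWT_Nil[OF \<iota>] by (force simp: B)+
    moreover have "u \<in> B" if u: "w \<in> B" "v \<in> B" "prefix w u" "prefix u v" for w v u
    proof -
      obtain x where x: "u = concat r @ x" using u(1,3) by (auto simp: B prefix_def)
      obtain y where "v = concat r @ y" "y \<in> pnodes (frag \<alpha> c r)" using u(2) by (auto simp: B)
      then show ?thesis using NWT_pnodes_prefix[OF \<iota>] u(4) by (auto simp: x B)
    qed
    ultimately show ?thesis unfolding fragmentation_def by blast
  qed
  ultimately show ?thesis by (auto simp: FFT_def split: prod.splits)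
qed

text \<open>Passing to the subtree at \<open>u\<close> removes \<open>u\<close> from the word and,
  at the same time, from the front of the root-path. This makes subtrees of the gluing gluings
  again.\<close>

lemma node_at_nwleaf_append_iff:
  assumes c: "c \<in> C" and u: "u \<in> nwleaf (fst (\<alpha> c))"
  shows "node_at \<alpha> c (u @ x) r v \<longleftrightarrow>
    (\<exists>s. r = u # s \<and> node_at \<alpha> (the (snd (\<alpha> c) u)) x s v)"
proof
  assume n: "node_at \<alpha> c (u @ x) r v"
  have "u @ x \<notin> pnodes (fst (\<alpha> c))"
    using NWT_pnodes_prefix[OF fragment_NWT[OF c], of "u @ x" u] u pnodes_nwleaf_disjoint by auto
  then obtain u' s where r: "r = u' # s" using n by (cases r) (auto simp: node_at_Nil)
  then obtain x' where x': "u' \<in> nwleaf (fst (\<alpha> c))" "u @ x = u' @ x'"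
      "node_at \<alpha> (the (snd (\<alpha> c) u')) x' s v"
    using n by (auto simp: node_at_Cons)
  then have "u = u' \<and> x = x'" using NWT_nwleaf_antichain[OF fragment_NWT[OF c] u] by blast
  then show "\<exists>s. r = u # s \<and> node_at \<alpha> (the (snd (\<alpha> c) u)) x s v" using r x'(3) by simp
qed (use u in \<open>auto simp: node_at_Cons\<close>)

lemma st_assemble:
  assumes c: "c \<in> C" and u: "u \<in> nwleaf (fst (\<alpha> c))"
    and dom: "u \<in> dom (fst (assemble \<alpha> c))"
  shows "st (assemble \<alpha> c) u = assemble \<alpha> (the (snd (\<alpha> c) u))"
proof (rule FFT_eqI)
  let ?d = "the (snd (\<alpha> c) u)"
  note d = successor_closed[OF c u]
  show "st (assemble \<alpha> c) u \<in> FFT" by (rule st_FFT[OF assemble_FFT[OF c] dom])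
  show "assemble \<alpha> ?d \<in> FFT" by (rule assemble_FFT[OF d])
  show "same_block (st (assemble \<alpha> c) u) w v \<longleftrightarrow> same_block (assemble \<alpha> ?d) w v" for w v
    unfolding same_block_st[OF assemble_FFT[OF c]] same_block_assemble node_at_nwleaf_append_iff[OF c u]
    by blast
  show "fst (st (assemble \<alpha> c) u) = fst (assemble \<alpha> ?d)"
  proof
    fix x
    show "fst (st (assemble \<alpha> c) u) x = fst (assemble \<alpha> ?d) x"
    proof (cases "\<exists>r v. node_at \<alpha> ?d x r v")
      case True
      then obtain r v where n: "node_at \<alpha> ?d x r v" by blast
      then have "node_at \<alpha> c (u @ x) (u # r) v" using node_at_nwleaf_append_iff[OF c u] by blast
      from frag_assemble[OF c this] frag_assemble[OF d n] show ?thesis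
        by (simp add: fst_st[OF assemble_FFT[OF c]])
    next
      case False
      then have "x \<notin> dom (fst (assemble \<alpha> ?d))" "u @ x \<notin> dom (fst (assemble \<alpha> c))"
        unfolding dom_assemble[OF c] dom_assemble[OF d] node_at_nwleaf_append_iff[OF c u] by blast+
      then show ?thesis unfolding fst_st[OF assemble_FFT[OF c]] by (simp only: domIff not_not)
    qed
  qed
qed

text \<open>The node \<open>[]\<close> has the empty root-path, so by uniqueness of coordinates its
  block is the set of proper nodes of the first fragment. The children leaving that block are the
  \<open>*\<close>-leaves, and the subtrees there are the gluings of the successors.\<close>

lemma destruct_assemble:
  assumes c: "c \<in> C"
  shows "destruct (assemble \<alpha> c) = T_map (assemble \<alpha>) (\<alpha> c)"
proof -
  let ?\<pi> = "assemble \<alpha> c" and ?\<iota> = "fst (\<alpha> c)"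
  note \<pi> = assemble_FFT[OF c] and \<iota> = fragment_NWT[OF c]
  have Nil: "node_at \<alpha> c [] [] []" using NWT_Nil[OF \<iota>] by (simp add: node_at_Nil)
  have block: "same_block ?\<pi> [] v \<longleftrightarrow> v \<in> pnodes ?\<iota>" for v
  proof
    assume "same_block ?\<pi> [] v"
    then obtain r x x' where "node_at \<alpha> c [] r x" and v: "node_at \<alpha> c v r x'"
      unfolding same_block_assemble by blast
    then have "r = []" using node_at_unique[OF c Nil] by blast
    then show "v \<in> pnodes ?\<iota>" using v by (simp add: node_at_Nil)
  next
    assume "v \<in> pnodes ?\<iota>"
    then have "node_at \<alpha> c v [] v" by (simp add: node_at_Nil)
    then show "same_block ?\<pi> [] v" using Nil unfolding same_block_assemble by blast
  qed
  have covers: "root_covers ?\<pi> [] v \<longleftrightarrow> v \<in> nwleaf ?\<iota>" for v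
  proof (cases v rule: rev_cases)
    case Nil
    then show ?thesis using not_root_covers_Nil_Nil[OF \<pi>] \<iota> by (auto simp: NWT_def)
  next
    case (snoc w i)
    have child: "w @ [i] \<in> dom (fst ?\<pi>) \<longleftrightarrow> w @ [i] \<in> dom ?\<iota>" if "w \<in> pnodes ?\<iota>"
      using node_at_child[OF c, of w "[]" w i] that by (simp add: node_at_Nil)
    have "root_covers ?\<pi> [] v \<longleftrightarrow> w \<in> pnodes ?\<iota> \<and> v \<in> dom ?\<iota> \<and> v \<notin> pnodes ?\<iota>"
      using child unfolding snoc root_covers_Nil_snoc_iff[OF \<pi>] block by blast
    also have "\<dots> \<longleftrightarrow> v \<in> nwleaf ?\<iota>"
      using NWT_parent[OF \<iota>, of w i] pnodes_nwleaf_disjoint[of v ?\<iota>] unfolding snoc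
      by (auto simp only: dom_nwt)
    finally show ?thesis .
  qed
  have tf: "tf ?\<pi> [] = ?\<iota>"
  proof
    fix v
    consider "v \<in> pnodes ?\<iota>" | "v \<in> nwleaf ?\<iota>" "v \<notin> pnodes ?\<iota>" | "v \<notin> dom ?\<iota>"
      by (auto simp: pnodes_def)
    then show "tf ?\<pi> [] v = ?\<iota> v"
    proof cases
      case 1
      then have "node_at \<alpha> c v [] v" by (simp add: node_at_Nil)
      from frag_assemble[OF c this] show ?thesis using 1 by (simp add: tf_Nil_eq[OF \<pi>] block)
    next
      case 2
      then show ?thesis by (simp add: tf_Nil_eq[OF \<pi>] block covers) (simp add: nwleaf_def)
    next
      case 3
      then have "v \<notin> pnodes ?\<iota>" "v \<notin> nwleaf ?\<iota>" by (auto simp: dom_nwt)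
      then show ?thesis using 3 by (simp add: tf_Nil_eq[OF \<pi>] block covers domIff)
    qed
  qed
  have "snd (destruct ?\<pi>) = map_option (assemble \<alpha>) \<circ> snd (\<alpha> c)"
  proof
    fix u
    show "snd (destruct ?\<pi>) u = (map_option (assemble \<alpha>) \<circ> snd (\<alpha> c)) u"
    proof (cases "u \<in> nwleaf ?\<iota>")
      case True
      then have "u \<in> dom (fst ?\<pi>)" using covers root_covers_Nil_dom[OF \<pi>] by blast
      then show ?thesis
        using st_assemble[OF c True] True successor_eq[OF c, of u]
        by (auto simp: destruct_def tf)
    next
      case False
      then show ?thesis using successor_eq[OF c, of u] by (auto simp: destruct_def tf)
    qed
  qed
  moreover have "fst (destruct ?\<pi>) = ?\<iota>" by (simp add: destruct_def tf)
  ultimately show ?thesis by (simp add: T_map_def case_prod_beta prod_eq_iff)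
qed

end


section \<open>Finality of the finite-fragmented trees\<close>

text \<open>Gluing now also applies to \<open>destruct\<close>, where it will turn out to be the
  identity; uniqueness of the morphism rests on this.\<close>

interpretation destruct: T_coalgebra FFT destruct
  by unfold_locales (use destruct_T_obj in blast)

text \<open>Iterated subtrees collapse to one subtree at the concatenated address. Both claims go
  through one induction, because \<open>st\<close> at that address is known to be in
  \<open>FFT\<close> only once the address is a node.\<close>

lemma concat_root_sub_destruct:
  assumes \<pi>: "\<pi> \<in> FFT" and "r \<in> Roots destruct \<pi>"
  shows "concat r \<in> roots \<pi> \<and> sub destruct \<pi> r = st \<pi> (concat r)"
  using assms(2)
proof (induction r rule: rev_induct)
  case Nil
  then show ?case using st_Nil[OF \<pi>] Nil_in_roots[OF \<pi>] by simp
next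
  case (snoc u r)
  then have r: "r \<in> Roots destruct \<pi>" and "u \<in> nwleaf (frag destruct \<pi> r)"
    by (simp_all add: snoc_in_Roots_iff)
  define w where "w = concat r"
  have w: "w \<in> roots \<pi>" "sub destruct \<pi> r = st \<pi> w" using snoc.IH[OF r] by (simp_all add: w_def)
  note st = st_FFT[OF \<pi> roots_dom[OF \<pi> w(1)]]
  have u: "u \<in> nwleaf (tf (st \<pi> w) [])"
    using \<open>u \<in> nwleaf (frag destruct \<pi> r)\<close> by (simp add: frag_sub w(2) destruct_def)
  then have cov: "root_covers (st \<pi> w) [] u" by (simp add: nwleaf_tf[OF st])
  then obtain x i where x: "u = x @ [i]"
    using not_root_covers_Nil_Nil[OF st] by (cases u rule: rev_cases) auto
  have "same_block \<pi> w (w @ x)" and dom: "w @ u \<in> dom (fst \<pi>)" and "\<not> same_block \<pi> w (w @ u)"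
    using cov unfolding x root_covers_Nil_snoc_iff[OF st] same_block_st[OF \<pi>] dom_st[OF \<pi>] by auto
  then have "\<not> same_block \<pi> (w @ x) (w @ u)" using same_block_trans[OF \<pi>] by blast
  then have "w @ u \<in> roots \<pi>" using snoc_in_roots_iff[OF \<pi>, of "w @ x" i] dom by (simp add: x)
  moreover have "sub destruct \<pi> (r @ [u]) = st (st \<pi> w) u"
    using u by (simp add: sub_append w(2) destruct_def)
  ultimately show ?case using st_st[OF \<pi> dom] by (simp add: w_def)
qed

lemma concat_in_roots: "\<pi> \<in> FFT \<Longrightarrow> r \<in> Roots destruct \<pi> \<Longrightarrow> concat r \<in> roots \<pi>"
  using concat_root_sub_destruct by blast

lemma frag_destruct:
  "\<pi> \<in> FFT \<Longrightarrow> r \<in> Roots destruct \<pi> \<Longrightarrow> frag destruct \<pi> r = tf (st \<pi> (concat r)) []"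
  by (simp add: frag_sub destruct_def concat_root_sub_destruct)

lemma st_concat_FFT:
  "\<pi> \<in> FFT \<Longrightarrow> r \<in> Roots destruct \<pi> \<Longrightarrow> st \<pi> (concat r) \<in> FFT"
  using st_FFT concat_in_roots roots_dom by blast

lemma pnodes_frag_destruct:
  assumes "\<pi> \<in> FFT" "r \<in> Roots destruct \<pi>"
  shows "v \<in> pnodes (frag destruct \<pi> r) \<longleftrightarrow> same_block \<pi> (concat r) (concat r @ v)"
  using assms
  by (simp add: frag_destruct pnodes_tf[OF st_concat_FFT] same_block_st)

text \<open>Leaving the block of \<open>concat r\<close> becomes being a root of the whole tree, a
  condition that no longer depends on the fragment.\<close>

lemma nwleaf_frag_destruct:
  assumes \<pi>: "\<pi> \<in> FFT" and r: "r \<in> Roots destruct \<pi>"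
  shows "v @ [i] \<in> nwleaf (frag destruct \<pi> r) \<longleftrightarrow>
    same_block \<pi> (concat r) (concat r @ v) \<and> concat r @ v @ [i] \<in> roots \<pi>"
proof -
  have "v @ [i] \<in> nwleaf (frag destruct \<pi> r) \<longleftrightarrow>
    same_block \<pi> (concat r) (concat r @ v) \<and> concat r @ v @ [i] \<in> dom (fst \<pi>)
      \<and> \<not> same_block \<pi> (concat r) (concat r @ v @ [i])"
    by (simp add: frag_destruct[OF \<pi> r] nwleaf_tf[OF st_concat_FFT[OF \<pi> r]]
        root_covers_Nil_snoc_iff[OF st_concat_FFT[OF \<pi> r]] same_block_st[OF \<pi>] dom_st[OF \<pi>]
        del: domIff)
  then show ?thesis
    using snoc_in_roots_iff[OF \<pi>, of "concat r @ v" i] roots_dom[OF \<pi>]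
      same_block_sym[OF \<pi>] same_block_trans[OF \<pi>] unfolding append_assoc by blast
qed

lemma node_at_destruct:
  assumes "\<pi> \<in> FFT"
  shows "node_at destruct \<pi> w r v \<longleftrightarrow>
    r \<in> Roots destruct \<pi> \<and> w = concat r @ v \<and> same_block \<pi> (concat r) w"
  using pnodes_frag_destruct[OF assms] unfolding node_at_def by blast

text \<open>Walk along the word: each letter either stays in the current block, extending
  \<open>v\<close>, or enters a new root, in which case \<open>v @ [i]\<close> is appended to the
  root-path and the position restarts at \<open>[]\<close>.\<close>

lemma ex_node_at_destruct:
  assumes \<pi>: "\<pi> \<in> FFT" and "w \<in> dom (fst \<pi>)"
  shows "\<exists>r v. node_at destruct \<pi> w r v"
  using assms(2)
proof (induction w rule: rev_induct)
  case Nil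
  then have "node_at destruct \<pi> [] [] []"
    using same_block_refl[OF \<pi>] by (simp add: node_at_destruct[OF \<pi>] Nil_in_Roots)
  then show ?case by blast
next
  case (snoc i w)
  then obtain r v where n: "r \<in> Roots destruct \<pi>" "w = concat r @ v" "same_block \<pi> (concat r) w"
    using is_tree_parent[OF FFT_tree[OF \<pi>]] unfolding node_at_destruct[OF \<pi>] by blast
  show ?case
  proof (cases "same_block \<pi> (concat r) (w @ [i])")
    case True
    then have "node_at destruct \<pi> (w @ [i]) r (v @ [i])"
      using n by (simp add: node_at_destruct[OF \<pi>])
    then show ?thesis by blast
  next
    case False
    then have "\<not> same_block \<pi> w (w @ [i])" using n(3) same_block_trans[OF \<pi>] by blast
    then have "w @ [i] \<in> roots \<pi>" using snoc_in_roots_iff[OF \<pi> snoc.prems] by blast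
    then have "v @ [i] \<in> nwleaf (frag destruct \<pi> r)"
      using n by (simp add: nwleaf_frag_destruct[OF \<pi>])
    then have "r @ [v @ [i]] \<in> Roots destruct \<pi>" using n(1) by (simp add: snoc_in_Roots_iff)
    moreover have "same_block \<pi> (w @ [i]) (w @ [i])" by (rule same_block_refl[OF \<pi> snoc.prems])
    ultimately have "node_at destruct \<pi> (w @ [i]) (r @ [v @ [i]]) []"
      using n(2) by (simp add: node_at_destruct[OF \<pi>])
    then show ?thesis by blast
  qed
qed

lemma assemble_destruct:
  assumes \<pi>: "\<pi> \<in> FFT"
  shows "assemble destruct \<pi> = \<pi>"
proof (rule FFT_eqI)
  show "assemble destruct \<pi> \<in> FFT" by (rule destruct.assemble_FFT[OF \<pi>])
  show "fst (assemble destruct \<pi>) = fst \<pi>"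
  proof
    fix w
    show "fst (assemble destruct \<pi>) w = fst \<pi> w"
    proof (cases "w \<in> dom (fst \<pi>)")
      case True
      then obtain r v where n: "node_at destruct \<pi> w r v" using ex_node_at_destruct[OF \<pi>] by blast
      then have r: "r \<in> Roots destruct \<pi>" "w = concat r @ v" "same_block \<pi> (concat r) w"
        unfolding node_at_destruct[OF \<pi>] by blast+
      have "frag destruct \<pi> r v = Some (fst \<pi> w)"
        using r(2,3)
        by (simp add: frag_destruct[OF \<pi> r(1)] tf_Nil_eq[OF st_concat_FFT[OF \<pi> r(1)]]
            same_block_st[OF \<pi>] fst_st[OF \<pi>])
      then show ?thesis using destruct.frag_assemble[OF \<pi> n] by simp
    next
      case False
      then have "w \<notin> dom (fst (assemble destruct \<pi>))"
        using same_block_dom[OF \<pi>]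
        unfolding destruct.dom_assemble[OF \<pi>] node_at_destruct[OF \<pi>] by blast
      then show ?thesis using False by (simp only: domIff not_not)
    qed
  qed
  show "same_block (assemble destruct \<pi>) w w' \<longleftrightarrow> same_block \<pi> w w'" for w w'
  proof
    assume "same_block (assemble destruct \<pi>) w w'"
    then show "same_block \<pi> w w'"
      using same_block_sym[OF \<pi>] same_block_trans[OF \<pi>]
      unfolding destruct.same_block_assemble node_at_destruct[OF \<pi>] by blast
  next
    assume b: "same_block \<pi> w w'"
    then obtain r v where r: "r \<in> Roots destruct \<pi>" "w = concat r @ v" "same_block \<pi> (concat r) w"
      using ex_node_at_destruct[OF \<pi>] same_block_dom[OF \<pi>]
      unfolding node_at_destruct[OF \<pi>] by blast
    then have b': "same_block \<pi> (concat r) w'" using b same_block_trans[OF \<pi>] by blast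
    \<comment> \<open>The start \<open>concat r\<close> is the minimum of the block, so every node
      of the block has coordinates with this same \<open>r\<close>.\<close>
    then have "prefix (concat r) w'" by (rule root_prefix[OF \<pi> concat_in_roots[OF \<pi> r(1)]])
    then obtain v' where "w' = concat r @ v'" by (auto simp: prefix_def)
    then show "same_block (assemble destruct \<pi>) w w'"
      using r b' unfolding destruct.same_block_assemble node_at_destruct[OF \<pi>] by blast
  qed
qed (rule \<pi>)

section \<open>Uniqueness of the morphism\<close>

context T_coalgebra
begin

lemma
  assumes F: "coalg_morphism C \<alpha> D \<beta> F"
  shows morphism_root_path: "c \<in> C \<Longrightarrow> is_root_path \<beta> (F c) r \<longleftrightarrow> is_root_path \<alpha> c r"
    and morphism_frag: "c \<in> C \<Longrightarrow> is_root_path \<alpha> c r \<Longrightarrow> frag \<beta> (F c) r = frag \<alpha> c r"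
proof -
  have fst_eq: "fst (\<beta> (F c)) = fst (\<alpha> c)" if "c \<in> C" for c
    using F that by (simp add: coalg_morphism_def T_map_def case_prod_beta)
  have succ: "the (snd (\<beta> (F c)) u) = F (the (snd (\<alpha> c) u))"
    if "c \<in> C" "u \<in> nwleaf (fst (\<alpha> c))" for c u
    using F that successor_eq[OF that(1), of u]
    by (auto simp: coalg_morphism_def T_map_def case_prod_beta)
  show "c \<in> C \<Longrightarrow> is_root_path \<beta> (F c) r \<longleftrightarrow> is_root_path \<alpha> c r"
    by (induction r arbitrary: c) (auto simp: fst_eq succ successor_closed)
  show "c \<in> C \<Longrightarrow> is_root_path \<alpha> c r \<Longrightarrow> frag \<beta> (F c) r = frag \<alpha> c r"
    by (induction r arbitrary: c) (auto simp: fst_eq succ successor_closed)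
qed

lemma coalg_morphism_assemble: "coalg_morphism C \<alpha> FFT destruct (assemble \<alpha>)"
  by (simp add: coalg_morphism_def assemble_FFT destruct_assemble)

lemma Roots_assemble: "c \<in> C \<Longrightarrow> Roots destruct (assemble \<alpha> c) = Roots \<alpha> c"
  by (simp add: Roots_def morphism_root_path[OF coalg_morphism_assemble])

lemma frag_destruct_assemble:
  "c \<in> C \<Longrightarrow> r \<in> Roots \<alpha> c \<Longrightarrow> frag destruct (assemble \<alpha> c) r = frag \<alpha> c r"
  by (simp add: Roots_def morphism_frag[OF coalg_morphism_assemble])

lemma morphism_unique:
  assumes F: "coalg_morphism C \<alpha> FFT destruct F" and c: "c \<in> C"
  shows "F c = assemble \<alpha> c"
proof -
  have Roots: "Roots destruct (F c) = Roots \<alpha> c"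
    by (simp add: Roots_def morphism_root_path[OF F c])
  have frag: "frag destruct (F c) r = frag \<alpha> c r" if "r \<in> Roots \<alpha> c" for r
    using that by (simp add: Roots_def morphism_frag[OF F c])
  have n: "node_at destruct (F c) = node_at \<alpha> c"
    by (intro ext) (auto simp: node_at_def Roots frag)
  \<comment> \<open>The two \<open>frag\<close> functions are known to agree on root-paths only, so
    they are exchanged under the guard \<open>node_at\<close>, as they occur in
    \<open>assemble\<close>.\<close>
  have "node_at \<alpha> c w r v \<and> frag destruct (F c) r v = Some x \<longleftrightarrow>
      node_at \<alpha> c w r v \<and> frag \<alpha> c r v = Some x" for w r v x
    by (auto simp: node_at_def frag)
  then have "assemble destruct (F c) = assemble \<alpha> c"
    unfolding assemble_def n Roots by presburger
  moreover have "F c \<in> FFT" using F c by (auto simp: coalg_morphism_def)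
  ultimately show ?thesis using assemble_destruct by metis
qed

end

lemma unfold_morphism_eq:
  assumes \<alpha>: "\<alpha> \<in> FFT \<rightarrow> T_obj FFT" and \<pi>: "\<pi> \<in> FFT"
  shows "unfold_morphism \<alpha> \<pi> = assemble \<alpha> \<pi>"
proof -
  interpret T_coalgebra FFT \<alpha> by unfold_locales (rule \<alpha>)
  let ?G = "restrict (assemble \<alpha>) FFT"
  \<comment> \<open>The description asks for an extensional function, hence the restriction. It is
    harmless because \<open>T_map\<close> applies its argument only to successors, which lie in
    \<open>FFT\<close>.\<close>
  have "T_map ?G (\<alpha> c) = T_map (assemble \<alpha>) (\<alpha> c)" if "c \<in> FFT" for c
  proof -
    have "map_option ?G (snd (\<alpha> c) u) = map_option (assemble \<alpha>) (snd (\<alpha> c) u)" for u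
    proof (cases "snd (\<alpha> c) u")
      case (Some d)
      then have "d \<in> FFT"
        using successor_closed[OF that, of u] successor_eq[OF that, of u] by simp
      then show ?thesis by (simp add: Some)
    qed simp
    then show ?thesis by (simp add: T_map_def case_prod_beta fun_eq_iff)
  qed
  then have G: "coalg_morphism FFT \<alpha> FFT destruct ?G"
    by (simp add: coalg_morphism_def assemble_FFT destruct_assemble)
  have "unfold_morphism \<alpha> = ?G"
    unfolding unfold_morphism_def
  proof (rule the_equality)
    show "?G \<in> extensional FFT \<and> coalg_morphism FFT \<alpha> FFT destruct ?G" using G by simp
  next
    fix F assume "F \<in> extensional FFT \<and> coalg_morphism FFT \<alpha> FFT destruct F"
    then show "F = ?G"
      using morphism_unique by (intro extensionalityI[of F FFT]) auto
  qed
  then show ?thesis using \<pi> by simp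
qed

section \<open>Finite-fragmented proofs\<close>

text \<open>Fragments do not occur here: a premise is a \<open>*\<close>-leaf of its fragment
  exactly if it is a root of the whole tree.\<close>

definition locally_correct :: "'s calculus \<Rightarrow> 's fft \<Rightarrow> word \<Rightarrow> bool" where
  "locally_correct C \<pi> w \<longleftrightarrow>
     rule_at (fst \<pi>) w \<in> rules C \<and> inst_at (fst \<pi>) w \<in> rule_at (fst \<pi>) w \<and>
     (\<forall>i < arity (fst \<pi>) w. w @ [i] \<in> roots \<pi> \<longleftrightarrow>
        i \<in> progress C (rule_at (fst \<pi>) w) (inst_at (fst \<pi>) w))"

text \<open>The premise functions to be compared have the form \<open>frag\<close> at
  \<open>r @ [w]\<close>, which runs through \<open>the None\<close> when \<open>w\<close> is not a
  \<open>*\<close>-leaf; they can be related on \<open>nwleaf\<close> only.\<close>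

lemma proof_fragment_cong:
  assumes "\<And>w. w \<in> nwleaf \<iota> \<Longrightarrow> s w = s' w"
  shows "proof_fragment C \<iota> s \<longleftrightarrow> proof_fragment C \<iota> s'"
proof -
  have "(\<lambda>i. if w @ [i] \<in> nwleaf \<iota> then s (w @ [i]) else nwt_seq \<iota> (w @ [i])) =
        (\<lambda>i. if w @ [i] \<in> nwleaf \<iota> then s' (w @ [i]) else nwt_seq \<iota> (w @ [i]))" for w
    using assms by auto
  then show ?thesis unfolding proof_fragment_def by simp
qed

lemma frag_destruct_label:
  assumes \<pi>: "\<pi> \<in> FFT" and r: "r \<in> Roots destruct \<pi>" and v: "v \<in> pnodes (frag destruct \<pi> r)"
  shows "frag destruct \<pi> r v = Some (fst \<pi> (concat r @ v))"
  using v unfolding pnodes_frag_destruct[OF \<pi> r]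
  by (simp add: frag_destruct[OF \<pi> r] tf_Nil_eq[OF st_concat_FFT[OF \<pi> r]]
      same_block_st[OF \<pi>] fst_st[OF \<pi>])

lemma arity_frag_destruct:
  assumes \<pi>: "\<pi> \<in> FFT" and r: "r \<in> Roots destruct \<pi>" and v: "v \<in> pnodes (frag destruct \<pi> r)"
  shows "arity (frag destruct \<pi> r) v = arity (fst \<pi>) (concat r @ v)"
proof -
  have "same_block (st \<pi> (concat r)) [] v"
    using v unfolding pnodes_frag_destruct[OF \<pi> r] same_block_st[OF \<pi>] by simp
  then have "arity (frag destruct \<pi> r) v = arity (fst (st \<pi> (concat r))) v"
    by (simp add: frag_destruct[OF \<pi> r] arity_tf[OF st_concat_FFT[OF \<pi> r]])
  then show ?thesis by (simp add: arity_def dom_st[OF \<pi>] del: domIff)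
qed

lemma proof_fragment_frag_destruct_iff:
  assumes \<pi>: "\<pi> \<in> FFT" and r: "r \<in> Roots destruct \<pi>"
  shows "proof_fragment C (frag destruct \<pi> r) (\<lambda>v. nwt_seq (frag destruct \<pi> (r @ [v])) []) \<longleftrightarrow>
    (\<forall>v \<in> pnodes (frag destruct \<pi> r). locally_correct C \<pi> (concat r @ v))"
proof -
  let ?\<iota> = "frag destruct \<pi> r" and ?t = "fst \<pi>"
  note \<iota> = destruct.frag_NWT[OF \<pi> r]
  have label: "nwt_seq ?\<iota> v = seq ?t (concat r @ v)" "nwt_rule ?\<iota> v = rule_at ?t (concat r @ v)"
    if "v \<in> pnodes ?\<iota>" for v
    using frag_destruct_label[OF \<pi> r that]
    by (simp_all add: nwt_seq_def seq_def nwt_rule_def rule_at_def)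
  \<comment> \<open>At a \<open>*\<close>-leaf the sequent is taken from the root of the next
    fragment, which is the same node of the whole tree.\<close>
  have premise: "(if v @ [i] \<in> nwleaf ?\<iota> then nwt_seq (frag destruct \<pi> (r @ [v @ [i]])) []
      else nwt_seq ?\<iota> (v @ [i])) = seq ?t (concat r @ v @ [i])"
    if v: "v \<in> pnodes ?\<iota>" and i: "i < arity ?\<iota> v" for v i
  proof (cases "v @ [i] \<in> nwleaf ?\<iota>")
    case True
    then have r': "r @ [v @ [i]] \<in> Roots destruct \<pi>" using r by (simp add: snoc_in_Roots_iff)
    show ?thesis
      using frag_destruct_label[OF \<pi> r' NWT_Nil[OF destruct.frag_NWT[OF \<pi> r']]] True
      by (simp add: nwt_seq_def seq_def)
  next
    case False
    have "is_tree ?\<iota>" "v \<in> dom ?\<iota>" using \<iota> v by (simp_all add: NWT_def dom_nwt del: domIff)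
    then have "v @ [i] \<in> dom ?\<iota>" using is_tree_child_iff i by blast
    then have "v @ [i] \<in> pnodes ?\<iota>" using False by (simp add: pnodes_def)
    then show ?thesis using label(1) False by simp
  qed
  have inst: "(map (\<lambda>i. if v @ [i] \<in> nwleaf ?\<iota> then nwt_seq (frag destruct \<pi> (r @ [v @ [i]])) []
      else nwt_seq ?\<iota> (v @ [i])) [0..<arity ?\<iota> v], nwt_seq ?\<iota> v) = inst_at ?t (concat r @ v)"
    if v: "v \<in> pnodes ?\<iota>" for v
    using premise[OF v] label(1)[OF v] arity_frag_destruct[OF \<pi> r v]
    by (simp add: inst_at_def)
  have leaf: "v @ [i] \<in> nwleaf ?\<iota> \<longleftrightarrow> (concat r @ v) @ [i] \<in> roots \<pi>" if "v \<in> pnodes ?\<iota>" for v i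
    using that unfolding nwleaf_frag_destruct[OF \<pi> r] pnodes_frag_destruct[OF \<pi> r] by simp
  have "proof_fragment C ?\<iota> (\<lambda>v. nwt_seq (frag destruct \<pi> (r @ [v])) []) \<longleftrightarrow>
    (\<forall>v \<in> pnodes ?\<iota>. nwt_rule ?\<iota> v \<in> rules C \<and> inst_at ?t (concat r @ v) \<in> nwt_rule ?\<iota> v \<and>
       (\<forall>i < arity ?\<iota> v. v @ [i] \<in> nwleaf ?\<iota> \<longleftrightarrow>
          i \<in> progress C (nwt_rule ?\<iota> v) (inst_at ?t (concat r @ v))))"
    unfolding proof_fragment_def Let_def using \<iota> by (simp add: inst cong: ball_cong)
  then show ?thesis
    unfolding locally_correct_def
    by (simp add: label leaf arity_frag_destruct[OF \<pi> r] cong: ball_cong)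
qed

lemma FFP_iff:
  assumes \<pi>: "\<pi> \<in> FFT"
  shows "\<pi> \<in> FFP C \<longleftrightarrow> (\<forall>w \<in> dom (fst \<pi>). locally_correct C \<pi> w)"
proof
  assume F: "\<pi> \<in> FFP C"
  show "\<forall>w \<in> dom (fst \<pi>). locally_correct C \<pi> w"
  proof
    fix w assume "w \<in> dom (fst \<pi>)"
    then obtain r v where n: "node_at destruct \<pi> w r v" using ex_node_at_destruct[OF \<pi>] by blast
    then have r: "r \<in> Roots destruct \<pi>" by (simp add: node_at_def)
    from F r have
      "proof_fragment C (frag destruct \<pi> r) (\<lambda>v. nwt_seq (frag destruct \<pi> (r @ [v])) [])"
      by (simp add: FFP_def)
    then show "locally_correct C \<pi> w"
      using n unfolding proof_fragment_frag_destruct_iff[OF \<pi> r] by (simp add: node_at_def)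
  qed
next
  assume *: "\<forall>w \<in> dom (fst \<pi>). locally_correct C \<pi> w"
  have "proof_fragment C (frag destruct \<pi> r) (\<lambda>v. nwt_seq (frag destruct \<pi> (r @ [v])) [])"
    if r: "r \<in> Roots destruct \<pi>" for r
    unfolding proof_fragment_frag_destruct_iff[OF \<pi> r] pnodes_frag_destruct[OF \<pi> r]
  proof
    fix v assume "v \<in> pnodes (frag destruct \<pi> r)"
    then have "concat r @ v \<in> dom (fst \<pi>)"
      using same_block_dom[OF \<pi>] unfolding pnodes_frag_destruct[OF \<pi> r] by blast
    then show "locally_correct C \<pi> (concat r @ v)" using * by blast
  qed
  then show "\<pi> \<in> FFP C" using \<pi> by (simp add: FFP_def)
qed

lemma FFP_is_proof:
  assumes "\<pi> \<in> FFP C"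
  shows "is_proof C (fst \<pi>)"
proof -
  have \<pi>: "\<pi> \<in> FFT" using assms by (simp add: FFP_def)
  note correct = bspec[OF assms[unfolded FFP_iff[OF \<pi>]]]
  have "preproof C (fst \<pi>)"
    using FFT_tree[OF \<pi>] FFT_labels[OF \<pi>] correct unfolding preproof_def locally_correct_def
    by blast
  moreover have "infinite {i. progressing C (fst \<pi>) (map b [0..<i])}"
    if b: "\<forall>i. map b [0..<i] \<in> dom (fst \<pi>)" for b
  proof
    assume "finite {i. progressing C (fst \<pi>) (map b [0..<i])}"
    then obtain N where N: "\<And>i. progressing C (fst \<pi>) (map b [0..<i]) \<Longrightarrow> i \<le> N"
      unfolding finite_nat_set_iff_bounded_le by blast
    \<comment> \<open>Position \<open>N\<close> itself may progress, but no later one does. A step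
      that does not progress enters no root and so stays in the block.\<close>
    have block: "same_block \<pi> (map b [0..<N]) (map b [0..<N + n])" for n
    proof (induction n)
      case 0
      show ?case using same_block_refl[OF \<pi>] b by simp
    next
      case (Suc n)
      let ?v = "map b [0..<N + n]" and ?i = "b (N + n)"
      have v: "?v \<in> dom (fst \<pi>)" and vi: "?v @ [?i] \<in> dom (fst \<pi>)"
        using spec[OF b, of "N + n"] spec[OF b, of "Suc (N + n)"] by (simp_all del: domIff)
      have "\<not> progressing C (fst \<pi>) (?v @ [?i])" using N[of "Suc (N + n)"] by auto
      then have "?i \<notin> progress C (rule_at (fst \<pi>) ?v) (inst_at (fst \<pi>) ?v)"
        using vi unfolding progressing_def by blast
      then have "?v @ [?i] \<notin> roots \<pi>"
        using correct[OF v] is_tree_child_iff[OF FFT_tree[OF \<pi>] v] vi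
        unfolding locally_correct_def by blast
      then have "same_block \<pi> ?v (?v @ [?i])" using snoc_in_roots_iff[OF \<pi> vi] by blast
      then have "same_block \<pi> (map b [0..<N]) (?v @ [?i])"
        using Suc.IH same_block_trans[OF \<pi>] by blast
      then show ?case by simp
    qed
    have "inj (\<lambda>n. map b [0..<N + n])"
      by (rule injI) (metis add_left_cancel diff_zero length_map length_upt)
    moreover have "range (\<lambda>n. map b [0..<N + n]) \<subseteq> {v. same_block \<pi> (map b [0..<N]) v}"
      using block by blast
    ultimately show False
      using same_block_finite[OF \<pi>] infinite_iff_countable_subset by blast
  qed
  ultimately show ?thesis unfolding is_proof_def by blast
qed


section \<open>Proofs are finite-fragmented\<close>

lemma np_path_prefix: "(np_edge C t)\<^sup>*\<^sup>* w v \<Longrightarrow> prefix w v"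
  by (induction rule: rtranclp_induct) (auto simp: np_edge_def)

text \<open>Each edge adds a single letter, so a path visits all prefixes between its ends.\<close>

lemma np_path_between:
  assumes "(np_edge C t)\<^sup>*\<^sup>* m v" "prefix m u" "prefix u v"
  shows "(np_edge C t)\<^sup>*\<^sup>* m u"
  using assms(1,3)
proof (induction rule: rtranclp_induct)
  case base
  then have "u = m" using assms(2) by (simp add: prefix_order.antisym)
  then show ?case by simp
next
  case (step y z)
  then show ?case
    using rtranclp.rtrancl_into_rtrancl[OF step.hyps(1,2)] by (auto simp: np_edge_def prefix_snoc)
qed

lemma np_edge_source_unique: "np_edge C t y z \<Longrightarrow> np_edge C t y' z \<Longrightarrow> y = y'"
  by (auto simp: np_edge_def)

text \<open>The edges form a forest, as each node has at most one predecessor. A backward step from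
  \<open>y\<close> to \<open>z\<close> therefore undoes the last edge of the path from
  \<open>m\<close> to \<open>y\<close>, or, if that path is empty, \<open>z\<close> replaces
  \<open>m\<close>.\<close>

lemma np_equiv_common_ancestor:
  assumes "equivclp (np_edge C t) w v"
  shows "\<exists>m. (np_edge C t)\<^sup>*\<^sup>* m w \<and> (np_edge C t)\<^sup>*\<^sup>* m v"
  using assms
proof (induction rule: equivclp_induct)
  case base
  show ?case by blast
next
  case (step y z)
  then obtain m where m: "(np_edge C t)\<^sup>*\<^sup>* m w" "(np_edge C t)\<^sup>*\<^sup>* m y" by blast
  show ?case
  proof (cases "np_edge C t y z")
    case True
    then show ?thesis using m by (meson rtranclp.rtrancl_into_rtrancl)
  next
    case False
    then have zy: "np_edge C t z y" using step.hyps(2) by blast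
    from m(2) show ?thesis
    proof (cases rule: rtranclp.cases)
      case rtrancl_refl
      then show ?thesis using zy m(1) by (meson converse_rtranclp_into_rtranclp rtranclp.rtrancl_refl)
    next
      case (rtrancl_into_rtrancl x)
      then have "(np_edge C t)\<^sup>*\<^sup>* m z" using np_edge_source_unique[OF _ zy] by blast
      then show ?thesis using m(1) by blast
    qed
  qed
qed

lemma np_equiv_dom:
  assumes "equivclp (np_edge C t) w v" "w \<in> dom t"
  shows "v \<in> dom t"
  using assms by (induction rule: equivclp_induct) (auto simp: np_edge_def simp del: domIff)

text \<open>Koenig's lemma: an infinite class would contain a branch that stops progressing.\<close>

lemma np_descendants_finite:
  assumes pf: "is_proof C t"
  shows "finite {v. (np_edge C t)\<^sup>*\<^sup>* m v}"
proof (rule ccontr)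
  let ?E = "np_edge C t"
  define P where "P x \<longleftrightarrow> infinite {v. ?E\<^sup>*\<^sup>* x v}" for x
  assume "infinite {v. ?E\<^sup>*\<^sup>* m v}"
  then have m: "P m" by (simp add: P_def)
  have tree: "is_tree t" using pf by (simp add: is_proof_def preproof_def)
  have "\<exists>i. ?E x (x @ [i]) \<and> P (x @ [i])" if "P x" for x
  proof (rule ccontr)
    assume no: "\<not> ?thesis"
    \<comment> \<open>If every child had finitely many descendants, a finite union over the children
      would bound those of \<open>x\<close>.\<close>
    have sub: "{v. ?E\<^sup>*\<^sup>* x v} \<subseteq>
        insert x (\<Union>i \<in> {i. i < arity t x \<and> ?E x (x @ [i])}. {v. ?E\<^sup>*\<^sup>* (x @ [i]) v})"
    proof
      fix v assume "v \<in> {v. ?E\<^sup>*\<^sup>* x v}"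
      then have "?E\<^sup>*\<^sup>* x v" by simp
      then show "v \<in> insert x (\<Union>i \<in> {i. i < arity t x \<and> ?E x (x @ [i])}. {v. ?E\<^sup>*\<^sup>* (x @ [i]) v})"
      proof (cases rule: converse_rtranclpE)
        case (step y)
        then obtain i where i: "y = x @ [i]" "x \<in> dom t" "x @ [i] \<in> dom t"
          unfolding np_edge_def by blast
        then have "i < arity t x" using is_tree_child_iff[OF tree] by blast
        then show ?thesis using step i(1) by blast
      qed simp
    qed
    have "finite {v. ?E\<^sup>*\<^sup>* x v}"
      by (rule finite_subset[OF sub]) (use no in \<open>auto simp: P_def\<close>)
    then show False using that by (simp add: P_def)
  qed
  then obtain nxt where nxt: "\<And>x. P x \<Longrightarrow> ?E x (x @ [nxt x]) \<and> P (x @ [nxt x])" by metis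
  define f where "f n = ((\<lambda>x. x @ [nxt x]) ^^ n) m" for n
  have f_Suc: "f (Suc n) = f n @ [nxt (f n)]" for n by (simp add: f_def)
  have P: "P (f n)" for n
    by (induction n) (use m nxt f_Suc in \<open>auto simp: f_def[of 0]\<close>)
  have edge: "?E (f n) (f (Suc n))" for n using nxt[OF P] f_Suc by simp
  have len: "length (f n) = length m + n" for n
    by (induction n) (auto simp: f_Suc f_def[of 0])
  have mono: "prefix (f n) (f (n + k))" for n k
    by (induction k) (auto simp: f_Suc intro: prefix_order.trans)
  \<comment> \<open>The branch is the limit of the words \<open>f n\<close>. The index
    \<open>Suc j\<close> makes the word longer than \<open>j\<close> even if \<open>m\<close> is
    empty.\<close>
  define b where "b j = f (Suc j) ! j" for j
  have nth: "f n ! j = b j" if "j < length m + n" for n j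
  proof -
    \<comment> \<open>Neither of \<open>f n\<close> and \<open>f (Suc j)\<close> is known to be the
      longer one; both are prefixes of \<open>f (n + Suc j)\<close>.\<close>
    have "f n ! j = f (n + Suc j) ! j"
      using mono[of n "Suc j"] that len[of n] by (auto simp: prefix_def nth_append)
    also have "\<dots> = f (Suc j) ! j"
      using mono[of "Suc j" n] len[of "Suc j"] by (auto simp: prefix_def nth_append add.commute)
    finally show ?thesis by (simp add: b_def)
  qed
  have branch: "map b [0..<length m + n] = f n" for n
    by (rule nth_equalityI) (simp_all add: len nth)
  have "map b [0..<i] \<in> dom t" for i
  proof -
    have "map b [0..<i] = take i (f i)" unfolding branch[symmetric] by (simp add: take_map)
    then have "prefix (map b [0..<i]) (f i)" by (simp add: take_is_prefix)
    moreover have "f i \<in> dom t" using edge[of i] by (simp add: np_edge_def del: domIff)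
    ultimately show ?thesis using is_tree_prefix[OF tree] by blast
  qed
  then have "infinite {i. progressing C t (map b [0..<i])}" using pf unfolding is_proof_def by blast
  \<comment> \<open>Prefixes of \<open>m\<close> may progress. All later positions are targets of
    edges and so do not.\<close>
  moreover have "{i. progressing C t (map b [0..<i])} \<subseteq> {..length m}"
  proof
    fix i assume i: "i \<in> {i. progressing C t (map b [0..<i])}"
    show "i \<in> {..length m}"
    proof (rule ccontr)
      assume "i \<notin> {..length m}"
      then obtain n where "i = length m + Suc n"
        using less_imp_Suc_add[of "length m" i] by auto
      then have "map b [0..<i] = f (Suc n)" by (simp only: branch)
      then show False using i edge[of n] by (simp add: np_edge_def)
    qed
  qed
  ultimately show False using finite_subset by blast
qed

text \<open>A shortest element \<open>m\<close> exists before finiteness is known. Its common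
  ancestor with any other element lies in the class and is a prefix of \<open>m\<close>, hence is
  \<open>m\<close>; so the class consists of the descendants of \<open>m\<close>.\<close>

lemma np_class_fragmentation:
  assumes pf: "is_proof C t"
  shows "fragmentation {v. equivclp (np_edge C t) x v}"
proof -
  let ?E = "np_edge C t" and ?B = "{v. equivclp (np_edge C t) x v}"
  obtain m where m: "m \<in> ?B" and least: "\<And>v. v \<in> ?B \<Longrightarrow> length m \<le> length v"
    using ex_has_least_nat[of "\<lambda>v. v \<in> ?B" x length] by auto
  have path: "?E\<^sup>*\<^sup>* m v" if "v \<in> ?B" for v
  proof -
    have "equivclp ?E m v" using m that equivclp_sym equivclp_trans by (metis mem_Collect_eq)
    then obtain m' where m': "?E\<^sup>*\<^sup>* m' m" "?E\<^sup>*\<^sup>* m' v" using np_equiv_common_ancestor by blast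
    have "m' \<in> ?B"
      using m converse_rtranclp_into_equivclp[OF m'(1)] equivclp_trans by (metis mem_Collect_eq)
    then have "m' = m"
      using least[of m'] np_path_prefix[OF m'(1)] by (auto simp: prefix_def)
    then show ?thesis using m'(2) by simp
  qed
  have in_class: "v \<in> ?B" if "?E\<^sup>*\<^sup>* m v" for v
    using m rtranclp_into_equivclp[OF that] equivclp_trans by (metis mem_Collect_eq)
  have "finite ?B"
    by (rule finite_subset[OF _ np_descendants_finite[OF pf, of m]]) (use path in blast)
  moreover have "prefix m v" if "v \<in> ?B" for v using np_path_prefix[OF path[OF that]] .
  moreover have "u \<in> ?B" if "w \<in> ?B" "v \<in> ?B" "prefix w u" "prefix u v" for w v u
    by (rule in_class, rule np_path_between[OF path[OF that(2)] _ that(4)])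
      (use np_path_prefix[OF path[OF that(1)]] that(3) in \<open>auto intro: prefix_order.trans\<close>)
  ultimately show ?thesis unfolding fragmentation_def using m by blast
qed

lemma np_classes_eq: "np_classes C t = (\<lambda>x. {v. equivclp (np_edge C t) x v}) ` dom t"
  by (auto simp: np_classes_def quotient_def simp del: domIff)

lemma proof_FFT:
  assumes pf: "is_proof C t"
  shows "(t, np_classes C t) \<in> FFT"
proof -
  have "is_tree t" "ran t \<subseteq> labels" using pf by (simp_all add: is_proof_def preproof_def)
  moreover have "partition_on (dom t) (np_classes C t)"
  proof (rule partition_onI)
    show "\<Union>(np_classes C t) = dom t"
      unfolding np_classes_eq
      using np_equiv_dom[of C t] equivclp_refl[of "np_edge C t"] by blast
  next
    fix B B' assume BB': "B \<in> np_classes C t" "B' \<in> np_classes C t" "B \<noteq> B'"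
    then obtain x y where xy: "B = {v. equivclp (np_edge C t) x v}"
        "B' = {v. equivclp (np_edge C t) y v}"
      unfolding np_classes_eq by blast
    have "B = B'" if "z \<in> B" "z \<in> B'" for z
    proof -
      have "equivclp (np_edge C t) x y"
        using that unfolding xy mem_Collect_eq by (meson equivclp_sym equivclp_trans)
      then show ?thesis
        unfolding xy by (intro Collect_cong) (meson equivclp_sym equivclp_trans)
    qed
    then show "disjnt B B'" using BB'(3) by (auto simp: disjnt_def)
  next
    show "{} \<notin> np_classes C t"
      unfolding np_classes_eq using equivclp_refl[of "np_edge C t"] by blast
  qed
  moreover have "\<forall>B \<in> np_classes C t. fragmentation B"
    unfolding np_classes_eq using np_class_fragmentation[OF pf] by blast
  ultimately show ?thesis by (simp add: FFT_def)
qed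

text \<open>The closure \<open>equivclp\<close> is reflexive on all words, blocks contain only
  nodes; hence the hypothesis on \<open>w\<close>.\<close>

lemma same_block_np_classes:
  assumes "w \<in> dom t"
  shows "same_block (t, np_classes C t) w v \<longleftrightarrow> equivclp (np_edge C t) w v"
proof
  assume "same_block (t, np_classes C t) w v"
  then obtain x where "equivclp (np_edge C t) x w" "equivclp (np_edge C t) x v"
    unfolding same_block_def np_classes_eq by auto
  then show "equivclp (np_edge C t) w v" by (meson equivclp_sym equivclp_trans)
next
  assume "equivclp (np_edge C t) w v"
  then have "w \<in> {v. equivclp (np_edge C t) w v}" "v \<in> {v. equivclp (np_edge C t) w v}"
    by simp_all
  moreover have "{v. equivclp (np_edge C t) w v} \<in> np_classes C t"
    using assms unfolding np_classes_eq by (rule imageI)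
  ultimately show "same_block (t, np_classes C t) w v"
    unfolding same_block_def snd_conv by blast
qed

text \<open>The generated equivalence might relate parent and child by a detour. But a common
  ancestor of both is a prefix of \<open>w\<close>, so its path to the child is nonempty and ends in
  an edge into the child, which only exists if the child does not progress.\<close>

lemma np_equiv_child_iff:
  assumes "w \<in> dom t" "w @ [i] \<in> dom t"
  shows "equivclp (np_edge C t) w (w @ [i]) \<longleftrightarrow> \<not> progressing C t (w @ [i])"
proof
  assume "equivclp (np_edge C t) w (w @ [i])"
  then obtain m where m: "(np_edge C t)\<^sup>*\<^sup>* m w" "(np_edge C t)\<^sup>*\<^sup>* m (w @ [i])"
    using np_equiv_common_ancestor by blast
  have "m \<noteq> w @ [i]" using prefix_length_le[OF np_path_prefix[OF m(1)]] by auto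
  then obtain y where "np_edge C t y (w @ [i])" using m(2) by (metis rtranclp.cases)
  then show "\<not> progressing C t (w @ [i])" unfolding np_edge_def by blast
next
  assume "\<not> progressing C t (w @ [i])"
  then have "np_edge C t w (w @ [i])" using assms by (simp add: np_edge_def)
  then show "equivclp (np_edge C t) w (w @ [i])" by blast
qed

lemma proof_FFP:
  assumes pf: "is_proof C t"
  shows "(t, np_classes C t) \<in> FFP C"
proof -
  let ?\<pi> = "(t, np_classes C t)"
  note \<pi> = proof_FFT[OF pf]
  have pre: "preproof C t" using pf by (simp add: is_proof_def)
  then have tree: "is_tree t" by (simp add: preproof_def)
  have "locally_correct C ?\<pi> w" if w: "w \<in> dom t" for w
  proof -
    have "w @ [i] \<in> roots ?\<pi> \<longleftrightarrow> i \<in> progress C (rule_at t w) (inst_at t w)"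
      if "i < arity t w" for i
    proof -
      have wi: "w @ [i] \<in> dom t" using that is_tree_child_iff[OF tree w] by blast
      have "w @ [i] \<in> roots ?\<pi> \<longleftrightarrow> progressing C t (w @ [i])"
        using snoc_in_roots_iff[OF \<pi>, of w i] wi
        by (simp add: same_block_np_classes[OF w] np_equiv_child_iff[OF w wi])
      then show ?thesis using wi unfolding progressing_def by blast
    qed
    then show ?thesis using pre w by (simp add: locally_correct_def preproof_def)
  qed
  then show ?thesis by (simp add: FFP_iff[OF \<pi>])
qed

section \<open>Proof translations\<close>

lemma frag_append: "frag \<alpha> c (r @ r') = frag \<alpha> (sub \<alpha> c r) r'"
  by (simp add: frag_sub sub_append)

lemma translation_step_sub_FFP:
  assumes "translation_step C0 C1 \<alpha>"
  shows "\<pi> \<in> FFP C0 \<Longrightarrow> r \<in> Roots \<alpha> \<pi> \<Longrightarrow> sub \<alpha> \<pi> r \<in> FFP C0"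
proof (induction r arbitrary: \<pi>)
  case (Cons u r)
  then have "sub \<alpha> \<pi> [u] \<in> FFP C0"
    using assms by (auto simp: translation_step_def Cons_in_Roots_iff)
  then show ?case using Cons by (simp add: Cons_in_Roots_iff)
qed simp

lemma assemble_FFP:
  assumes step: "translation_step C0 C1 \<alpha>" and \<pi>: "\<pi> \<in> FFP C0"
  shows "assemble \<alpha> \<pi> \<in> FFP C1"
proof -
  interpret T_coalgebra FFT \<alpha>
    by unfold_locales (use step in \<open>simp add: translation_step_def\<close>)
  have FFT: "\<pi> \<in> FFT" using \<pi> by (simp add: FFP_def)
  have "proof_fragment C1 (frag destruct (assemble \<alpha> \<pi>) r)
      (\<lambda>v. nwt_seq (frag destruct (assemble \<alpha> \<pi>) (r @ [v])) [])"
    if "r \<in> Roots destruct (assemble \<alpha> \<pi>)" for r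
  proof -
    have r: "r \<in> Roots \<alpha> \<pi>" using that by (simp add: Roots_assemble[OF FFT])
    let ?\<rho> = "sub \<alpha> \<pi> r"
    have "?\<rho> \<in> FFP C0" by (rule translation_step_sub_FFP[OF step \<pi> r])
    \<comment> \<open>A translation step constrains only the first fragment and its successors;
      applied to the subelement at \<open>r\<close>, this becomes the condition on the fragment at
      \<open>r\<close>.\<close>
    then have "proof_fragment C1 (frag \<alpha> ?\<rho> []) (\<lambda>w. nwt_seq (frag \<alpha> ?\<rho> [w]) [])"
      using step unfolding translation_step_def by blast
    then have fragment:
      "proof_fragment C1 (frag \<alpha> \<pi> r) (\<lambda>w. nwt_seq (frag \<alpha> \<pi> (r @ [w])) [])"
      by (simp add: frag_append frag_sub[of \<alpha> \<pi> r])
    have premise: "nwt_seq (frag destruct (assemble \<alpha> \<pi>) (r @ [w])) [] =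
        nwt_seq (frag \<alpha> \<pi> (r @ [w])) []"
      if "w \<in> nwleaf (frag \<alpha> \<pi> r)" for w
      using r that by (simp add: frag_destruct_assemble[OF FFT] snoc_in_Roots_iff)
    show ?thesis
      unfolding frag_destruct_assemble[OF FFT r]
      by (rule iffD2[OF proof_fragment_cong fragment]) (rule premise)
  qed
  then show ?thesis using assemble_FFT[OF FFT] by (simp add: FFP_def)
qed

theorem theorem3p8:
  fixes C0 C1 :: "'s calculus"
    and \<alpha> :: "'s fft \<Rightarrow> 's nwt \<times> (word \<rightharpoonup> 's fft)"
  assumes "local_progress_calculus C0"
    and "local_progress_calculus C1"
    and "translation_step C0 C1 \<alpha>"
  shows "unfold_morphism \<alpha> ` FFP C0 \<subseteq> FFP C1
    \<and> (\<forall>\<tau>. is_proof C0 \<tau> \<longrightarrow> is_proof C1 (fst (unfold_morphism \<alpha> (\<tau>, np_classes C0 \<tau>))))"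
proof -
  have "\<alpha> \<in> FFT \<rightarrow> T_obj FFT" using assms(3) by (simp add: translation_step_def)
  then have *: "unfold_morphism \<alpha> \<pi> \<in> FFP C1" if "\<pi> \<in> FFP C0" for \<pi>
    using assemble_FFP[OF assms(3) that] that unfold_morphism_eq[of \<alpha> \<pi>] by (simp add: FFP_def)
  then show ?thesis using FFP_is_proof proof_FFP by blast
qed

end
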